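(* Let $\alpha\in[0,\infty)$. Given $f,g\in\mathcal P_{2+\alpha}(\mathbb R^3)$ with equal moments up to order $2+[\alpha]$, there exists an explicit constant $\mathfrak A(\alpha,e,\eta)>0$, given by $$\mathfrak A(\alpha,e,\eta)=\frac{2}{4+\alpha}\left\langle\left(\frac{1+\tilde e}{2}\right)^{2+\alpha}+\frac{1-\left|\frac{1-\tilde e}{2}\right|^{4+\alpha}}{1-\left|\frac{1-\tilde e}{2}\right|^{2}}\right\rangle,$$ such that $$d_{2+\alpha}\big(\tilde Q_e^+(f,f),\tilde Q_e^+(g,g)\big)\le\mathfrak A(\alpha,e,\eta)\,d_{2+\alpha}(f,g).$$
   Context: $\mathcal P_{s}(\mathbb R^3)$ is the set of Borel probability measures on $\mathbb R^3$ with finite moment of order $s$ (written as densities $f(v)\,dv$ even if not absolutely continuous); $[\alpha]$ is the integer part of $\alpha$; equal moments up to order $n$ means $\int v^\kappa df=\int v^\kappa dg$ for all multi-indices $\kappa$ with $|\kappa|\le n$. Let $0\le e\le 1$ and let $\eta$ be a real random variable with law a probability measure $\mu$ supported in $[-e,\infty)$, with $\langle\eta\rangle=0$ and $\langle\eta^2\rangle=\beta^2$, where $\langle\cdot\rangle$ denotes expectation with respect to $\eta$ (integration against $\mu$). Put $\tilde e=e+\eta\ge0$. For $v,w\in\mathbb R^3$, $\sigma\in S^2$, the post-collision velocity is $$v'=\tfrac12(v+w)+\tfrac{1-\tilde e}{4}(v-w)+\tfrac{1+\tilde e}{4}|v-w|\sigma .$$ The gain operator $\tilde Q_e^+(f,f)$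 is the probability measure on $\mathbb R^3$ defined by $$(\varphi,\tilde Q_e^+(f,f))=\frac1{4\pi}\Big\langle\int_{\mathbb R^3}\int_{\mathbb R^3}\int_{S^2} f(v)f(w)\,\varphi(v')\,d\sigma\,dv\,dw\Big\rangle$$ for bounded continuous $\varphi$. The constant is equivalently written (this fixes the value of the quotient, by continuity, when $|1-\tilde e|=2$) $$\mathfrak A(\alpha,e,\eta)=\frac12\Big\langle\int_0^\pi\Big\{\Big[\big(\tfrac{1+\tilde e}{4}\big)^2 2(1-\cos\vartheta)\Big]^{\frac{2+\alpha}2}+\Big[\big(\tfrac{3-\tilde e}{4}\big)^2+\big(\tfrac{1+\tilde e}{4}\big)^2+2\,\tfrac{3-\tilde e}{4}\,\tfrac{1+\tilde e}{4}\cos\vartheta\Big]^{\frac{2+\alpha}2}\Big\}\sin\vartheta\,d\vartheta\Big\rangle .$$ With $\hat f(k)=\int e^{-iv\cdot k}\,df(v)$, the Fourier-based metric is, for $s>0$, $d_s(f,g)=\sup_{k\in\mathbb R^3\setminus\{0\}}\dfrac{|\hat f(k)-\hat g(k)|}{|k|^s}$. *)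

theory Defs
  imports "HOL-Probability.Probability"
begin

definition prob_moment :: "real \<Rightarrow> (real^3) measure set"
  where "prob_moment s =
    {f. prob_space f \<and> sets f = sets borel \<and> integrable f (\<lambda>v. norm v powr s)}"

definition equal_moments :: "nat \<Rightarrow> (real^3) measure \<Rightarrow> (real^3) measure \<Rightarrow> bool"
  where "equal_moments n f g \<longleftrightarrow>
    (\<forall>\<kappa> :: 3 \<Rightarrow> nat. (\<Sum>i\<in>UNIV. \<kappa> i) \<le> n \<longrightarrow>
      (\<integral>v. (\<Prod>i\<in>UNIV. (v $ i) ^ \<kappa> i) \<partial>f) = (\<integral>v. (\<Prod>i\<in>UNIV. (v $ i) ^ \<kappa> i) \<partial>g))"

definition fourier :: "(real^3) measure \<Rightarrow> real^3 \<Rightarrow> complex"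
  where "fourier f k = (\<integral>v. exp (- \<i> * complex_of_real (v \<bullet> k)) \<partial>f)"

text \<open>The supremum is taken in \<open>[0,\<infinity>]\<close>, so that no finiteness is presupposed.\<close>

definition fourier_dist :: "real \<Rightarrow> (real^3) measure \<Rightarrow> (real^3) measure \<Rightarrow> ennreal"
  where "fourier_dist s f g =
    (SUP k\<in>UNIV - {0}. ennreal (cmod (fourier f k - fourier g k) / norm k powr s))"

text \<open>Surface measure on the unit sphere of a Euclidean space of dimension \<open>n\<close>, by polar
  coordinates: the area of \<open>A\<close> is \<open>n\<close> times the Lebesgue measure of the cone
  \<open>{t x | x \<in> A, 0 < t < 1}\<close>. Here \<open>sgn x\<close> is the radial projection \<open>x / |x|\<close>.\<close>

definition sphere_measure :: "'a::euclidean_space measure"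
  where "sphere_measure =
    scale_measure (ennreal (real DIM('a)))
      (distr (restrict_space lborel (ball 0 1 - {0})) (restrict_space borel (sphere 0 1)) sgn)"

text \<open>In the following, \<open>et\<close> stands for the perturbed restitution coefficient \<open>e + \<eta>\<close>.\<close>

definition post_velocity :: "real \<Rightarrow> real^3 \<Rightarrow> real^3 \<Rightarrow> real^3 \<Rightarrow> real^3"
  where "post_velocity et v w \<sigma> =
    (1/2) *\<^sub>R (v + w) + ((1 - et) / 4) *\<^sub>R (v - w) + ((1 + et) / 4 * norm (v - w)) *\<^sub>R \<sigma>"

definition is_gain :: "real \<Rightarrow> real measure \<Rightarrow> (real^3) measure \<Rightarrow> (real^3) measure \<Rightarrow> bool"
  where "is_gain e \<mu> f Q \<longleftrightarrow> prob_space Q \<and> sets Q = sets borel \<and>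
    (\<forall>\<phi> :: real^3 \<Rightarrow> real. continuous_on UNIV \<phi> \<and> bounded (range \<phi>) \<longrightarrow>
      (\<integral>x. \<phi> x \<partial>Q) =
        1 / (4 * pi) * (\<integral>\<eta>. (\<integral>v. (\<integral>w. (\<integral>\<sigma>. \<phi> (post_velocity (e + \<eta>) v w \<sigma>)
          \<partial>sphere_measure) \<partial>f) \<partial>f) \<partial>\<mu>))"

definition gain :: "real \<Rightarrow> real measure \<Rightarrow> (real^3) measure \<Rightarrow> (real^3) measure"
  where "gain e \<mu> f = (THE Q. is_gain e \<mu> f Q)"

text \<open>The quotient \<open>(1 - x\<^bsup>4+\<alpha>\<^esup>) / (1 - x\<^sup>2)\<close>, extended by continuity to \<open>x = 1\<close>.\<close>

definition contraction_quotient :: "real \<Rightarrow> real \<Rightarrow> real"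
  where "contraction_quotient \<alpha> x =
    (if x = 1 then (4 + \<alpha>) / 2 else (1 - x powr (4 + \<alpha>)) / (1 - x\<^sup>2))"

text \<open>The integrand is nonnegative for \<open>e + \<eta> \<ge> 0\<close>; the expectation is taken in \<open>[0,\<infinity>]\<close>
  because \<open>\<eta>\<close> need not have a finite moment of order \<open>2 + \<alpha>\<close> when \<open>\<alpha> > 0\<close>.\<close>

definition contraction_const :: "real \<Rightarrow> real \<Rightarrow> real measure \<Rightarrow> ennreal"
  where "contraction_const \<alpha> e \<mu> =
    ennreal (2 / (4 + \<alpha>)) *
      (\<integral>\<^sup>+\<eta>. ennreal (((1 + (e + \<eta>)) / 2) powr (2 + \<alpha>)
        + contraction_quotient \<alpha> \<bar>(1 - (e + \<eta>)) / 2\<bar>) \<partial>\<mu>)"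

lemma contraction_quotient_tendsto:
  "(contraction_quotient \<alpha> \<longlongrightarrow> contraction_quotient \<alpha> 1) (at 1)"
proof -
  have "((\<lambda>x::real. (1 - x powr (4 + \<alpha>)) / (1 - x\<^sup>2)) \<longlongrightarrow> (4 + \<alpha>) / 2) (at 1)"
  proof (rule lhopital)
    show "((\<lambda>x::real. 1 - x powr (4 + \<alpha>)) \<longlongrightarrow> 0) (at 1)"
      by (rule tendsto_eq_intros refl | simp)+
    show "((\<lambda>x::real. 1 - x\<^sup>2) \<longlongrightarrow> 0) (at 1)"
      by (rule tendsto_eq_intros refl | simp)+
    have ev: "\<forall>\<^sub>F x::real in at 1. x \<in> {0<..} - {1}"
      by (rule eventually_at_in_open) auto
    show "\<forall>\<^sub>F x::real in at 1. 1 - x\<^sup>2 \<noteq> 0"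
      using ev by eventually_elim (auto simp: power2_eq_1_iff)
    show "\<forall>\<^sub>F x::real in at 1. - 2 * x \<noteq> 0"
      using ev by eventually_elim auto
    show "\<forall>\<^sub>F x::real in at 1.
        ((\<lambda>x. 1 - x powr (4 + \<alpha>)) has_real_derivative - (4 + \<alpha>) * x powr (3 + \<alpha>)) (at x)"
      using ev by eventually_elim (auto intro!: derivative_eq_intros simp: algebra_simps)
    show "\<forall>\<^sub>F x::real in at 1. ((\<lambda>x. 1 - x\<^sup>2) has_real_derivative - 2 * x) (at x)"
      by (intro always_eventually allI) (auto intro!: derivative_eq_intros)
    show "((\<lambda>x. - (4 + \<alpha>) * x powr (3 + \<alpha>) / (- 2 * x)) \<longlongrightarrow> (4 + \<alpha>) / 2) (at 1)"
      by (rule tendsto_eq_intros refl | simp add: field_simps)+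
  qed
  moreover have "\<forall>\<^sub>F x in at 1. (1 - x powr (4 + \<alpha>)) / (1 - x\<^sup>2) = contraction_quotient \<alpha> x"
    by (auto simp: contraction_quotient_def eventually_at_filter)
  ultimately show ?thesis
    by (simp add: contraction_quotient_def[of \<alpha> 1] tendsto_cong)
qed

lemma sgn_measurable_sphere:
  "(sgn :: 'a::euclidean_space \<Rightarrow> 'a) \<in>
    restrict_space lborel (ball 0 1 - {0}) \<rightarrow>\<^sub>M restrict_space borel (sphere 0 1)"
  by (intro measurable_restrict_space3) (auto simp: norm_sgn)

lemma emeasure_sphere_measure:
  "emeasure (sphere_measure :: (real^3) measure) (sphere 0 1) = ennreal (4 * pi)"
proof -
  have pre: "sgn -` sphere 0 1 \<inter> (ball 0 1 - {0}) = ball 0 1 - {0::real^3}"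
    by (auto simp: norm_sgn)
  have "emeasure (sphere_measure :: (real^3) measure) (sphere 0 1)
      = 3 * emeasure lborel (ball 0 1 - {0::real^3})"
    unfolding sphere_measure_def
    by (subst emeasure_scale_measure, subst emeasure_distr[OF sgn_measurable_sphere])
       (auto simp: sets_restrict_space space_restrict_space emeasure_restrict_space pre)
  also have "emeasure lborel (ball 0 1 - {0::real^3}) = emeasure lborel (ball (0::real^3) 1)"
    by (intro emeasure_Diff_null_set) auto
  also have "\<dots> = ennreal (4 / 3 * pi)"
    using unit_ball_vol_numeral(2)[of num.One]
    by (simp add: emeasure_ball fact_numeral)
  also have "3 * \<dots> = ennreal (4 * pi)"
    by (subst ennreal_numeral[symmetric], subst ennreal_mult[symmetric]) auto
  finally show ?thesis .
qed

lemma space_sphere_measure: "space (sphere_measure :: (real^3) measure) = sphere 0 1"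
  by (auto simp: sphere_measure_def space_scale_measure space_restrict_space)

lemma sets_sphere_measure [measurable_cong]:
  "sets (sphere_measure :: (real^3) measure) = sets (restrict_space borel (sphere 0 1))"
  by (simp add: sphere_measure_def)

text \<open>The gain measure is well defined: the weak formulation has exactly one solution.\<close>

lemma measure_eq_if_integral_bounded_continuous_eq:
  fixes P Q :: "'a::metric_space measure"
  assumes P: "prob_space P" "sets P = sets borel" and Q: "prob_space Q" "sets Q = sets borel"
    and eq: "\<And>\<phi> :: 'a \<Rightarrow> real. continuous_on UNIV \<phi> \<Longrightarrow> bounded (range \<phi>) \<Longrightarrow>
      (\<integral>x. \<phi> x \<partial>P) = (\<integral>x. \<phi> x \<partial>Q)"
  shows "P = Q"
proof -
  interpret P: prob_space P by fact
  interpret Q: prob_space Q by fact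
  have lim: "(\<lambda>n. \<integral>x. max 0 (1 - real n * infdist x C) \<partial>M) \<longlonglongrightarrow> measure M C"
    if C: "closed C" "C \<noteq> {}" and M: "prob_space M" "sets M = sets borel"
    for C and M :: "'a measure"
  proof -
    interpret M: prob_space M by fact
    have [measurable]: "C \<in> sets M" using C M by simp
    have pt: "(\<lambda>n. max 0 (1 - real n * infdist x C)) \<longlonglongrightarrow> indicat_real C x" for x
    proof (cases "x \<in> C")
      case False
      then have d: "infdist x C > 0" using C infdist_pos_not_in_closed by blast
      have "\<forall>\<^sub>F n in sequentially. 1 / infdist x C \<le> real n"
        by (rule eventually_compose_filterlim[OF eventually_ge_at_top filterlim_real_sequentially])
      then have "\<forall>\<^sub>F n in sequentially. max 0 (1 - real n * infdist x C) = 0"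
        by eventually_elim (use d in \<open>auto simp: field_simps max_def\<close>)
      with False show ?thesis by (simp add: tendsto_eventually)
    qed simp
    have "(\<lambda>n. \<integral>x. max 0 (1 - real n * infdist x C) \<partial>M) \<longlonglongrightarrow> (\<integral>x. indicat_real C x \<partial>M)"
    proof (rule integral_dominated_convergence[where w = "\<lambda>_. 1"])
      show "(\<lambda>x. max 0 (1 - real n * infdist x C)) \<in> borel_measurable M" for n
        unfolding measurable_cong_sets[OF M(2) refl]
        by (intro borel_measurable_continuous_onI continuous_intros)
    qed (auto simp: pt infdist_nonneg)
    then show ?thesis by simp
  qed
  have closed_eq: "emeasure P C = emeasure Q C" if "closed C" for C
  proof (cases "C = {}")
    case False
    have "(\<integral>x. max 0 (1 - real n * infdist x C) \<partial>P) = (\<integral>x. max 0 (1 - real n * infdist x C) \<partial>Q)"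
      for n
      by (intro eq continuous_intros boundedI[where B = 1]) (auto simp: infdist_nonneg)
    then have "measure P C = measure Q C"
      using lim[OF that False P] lim[OF that False Q] LIMSEQ_unique by auto
    then show ?thesis
      by (simp add: P.emeasure_eq_measure Q.emeasure_eq_measure)
  qed simp
  show ?thesis
  proof (rule measure_eqI_generator_eq[where E = "Collect closed" and \<Omega> = UNIV and A = "\<lambda>_. UNIV"])
    show "Int_stable (Collect (closed :: 'a set \<Rightarrow> bool))" by (auto simp: Int_stable_def)
  qed (auto simp: closed_eq P Q borel_eq_closed)
qed

lemma is_gain_ex1:
  assumes mu: "real_distribution \<mu>" and f: "prob_space f" "sets f = sets borel"
  shows "\<exists>!Q. is_gain e \<mu> f Q"
proof (rule ex_ex1I)
  interpret mu: real_distribution \<mu> by fact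
  interpret f: prob_space f by fact
  note [measurable_cong] = f(2)
  define S where "S = (scale_measure (ennreal (1 / (4 * pi))) sphere_measure :: (real^3) measure)"
  have "space S = sphere 0 1"
    by (simp add: S_def space_scale_measure space_sphere_measure)
  then have "emeasure S (space S) = ennreal (1 / (4 * pi)) * ennreal (4 * pi)"
    by (simp add: S_def emeasure_sphere_measure)
  also have "\<dots> = 1" by (subst ennreal_mult[symmetric]) auto
  finally have "emeasure S (space S) = 1" .
  then interpret S: prob_space S by (rule prob_spaceI)
  have setsS [measurable_cong]: "sets S = sets (restrict_space borel (sphere 0 1))"
    by (simp add: S_def sets_sphere_measure)
  have id [measurable]: "(\<lambda>\<sigma>. \<sigma>) \<in> borel_measurable S"
    unfolding measurable_cong_sets[OF setsS refl] by (rule measurable_restrict_space1) simp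
  have int_S: "(\<integral>\<sigma>. h \<sigma> \<partial>S) = 1 / (4 * pi) * (\<integral>\<sigma>. h \<sigma> \<partial>sphere_measure)"
    for h :: "real^3 \<Rightarrow> real"
  proof -
    have "S = density sphere_measure (\<lambda>_. ennreal (1 / (4 * pi)))"
      by (rule measure_eqI) (auto simp: S_def emeasure_density nn_integral_cmult_indicator)
    then show ?thesis
      by (cases "h \<in> borel_measurable sphere_measure")
         (auto simp: integral_density not_integrable_integral_eq integrable_iff_bounded)
  qed
  interpret fS: pair_prob_space f S ..
  interpret ffS: pair_prob_space f "f \<Otimes>\<^sub>M S" ..
  interpret mffS: pair_prob_space \<mu> "f \<Otimes>\<^sub>M (f \<Otimes>\<^sub>M S)" ..
  define T where "T = (\<lambda>(\<eta>, v, w, \<sigma>). post_velocity (e + \<eta>) v w \<sigma>)"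
  have T [measurable]: "T \<in> borel_measurable (\<mu> \<Otimes>\<^sub>M (f \<Otimes>\<^sub>M (f \<Otimes>\<^sub>M S)))"
    unfolding T_def post_velocity_def by measurable
  define Q where "Q = distr (\<mu> \<Otimes>\<^sub>M (f \<Otimes>\<^sub>M (f \<Otimes>\<^sub>M S))) borel T"
  have "is_gain e \<mu> f Q"
    unfolding is_gain_def
  proof (intro conjI allI impI)
    show "prob_space Q" unfolding Q_def by (rule mffS.prob_space_distr) (rule T)
    show "sets Q = sets borel" by (simp add: Q_def)
    fix \<phi> :: "real^3 \<Rightarrow> real"
    assume "continuous_on UNIV \<phi> \<and> bounded (range \<phi>)"
    then have [measurable]: "\<phi> \<in> borel_measurable borel" and "bounded (range \<phi>)"
      by (auto intro: borel_measurable_continuous_onI)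
    then obtain B where B: "\<And>x. \<bar>\<phi> x\<bar> \<le> B" by (auto simp: bounded_iff)
    have "(\<integral>x. \<phi> x \<partial>Q) = (\<integral>z. \<phi> (T z) \<partial>(\<mu> \<Otimes>\<^sub>M (f \<Otimes>\<^sub>M (f \<Otimes>\<^sub>M S))))"
      unfolding Q_def by (rule integral_distr) measurable
    also have "\<dots> = (\<integral>\<eta>. (\<integral>z. \<phi> (T (\<eta>, z)) \<partial>(f \<Otimes>\<^sub>M (f \<Otimes>\<^sub>M S))) \<partial>\<mu>)"
      by (rule mffS.integral_fst'[symmetric]) (auto intro!: mffS.integrable_const_bound[where B = B] B)
    also have "\<dots> = (\<integral>\<eta>. (\<integral>v. (\<integral>z. \<phi> (T (\<eta>, v, z)) \<partial>(f \<Otimes>\<^sub>M S)) \<partial>f) \<partial>\<mu>)"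
      by (intro Bochner_Integration.integral_cong refl ffS.integral_fst'[symmetric])
         (auto intro!: ffS.integrable_const_bound[where B = B] B)
    also have "\<dots> = (\<integral>\<eta>. (\<integral>v. (\<integral>w. (\<integral>\<sigma>. \<phi> (T (\<eta>, v, w, \<sigma>)) \<partial>S) \<partial>f) \<partial>f) \<partial>\<mu>)"
      by (intro Bochner_Integration.integral_cong refl fS.integral_fst'[symmetric])
         (auto intro!: fS.integrable_const_bound[where B = B] B)
    finally show "(\<integral>x. \<phi> x \<partial>Q) =
        1 / (4 * pi) * (\<integral>\<eta>. (\<integral>v. (\<integral>w. (\<integral>\<sigma>. \<phi> (post_velocity (e + \<eta>) v w \<sigma>)
          \<partial>sphere_measure) \<partial>f) \<partial>f) \<partial>\<mu>)"
      by (simp add: int_S T_def)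
  qed
  then show "\<exists>Q. is_gain e \<mu> f Q" ..
next
  fix Q Q' assume "is_gain e \<mu> f Q" "is_gain e \<mu> f Q'"
  then show "Q = Q'"
    by (intro measure_eq_if_integral_bounded_continuous_eq) (auto simp: is_gain_def)
qed

end

theory Submission
  imports Defs
begin

text \<open>
  On the Fourier side the gain operator is explicit. In \<open>v' \<bullet> k\<close> the collision direction \<open>\<sigma>\<close> occurs
  only in the term \<open>|v - w| (\<sigma> \<bullet> k)\<close>, and by rotation invariance of the sphere the average over \<open>\<sigma>\<close>
  does not change when this is replaced by \<open>|k| (\<sigma> \<bullet> (v - w))\<close>. The phase is then
  linear in \<open>v\<close> and \<open>w\<close>, and the transform of the gain measure is the average over \<open>\<eta>\<close> and \<open>\<sigma>\<close> of
  \<open>fourier f k\<^sup>+ * fourier f k\<^sup>-\<close>, where the frequencies \<open>k\<^sup>+\<close> and \<open>k\<^sup>-\<close> (\<open>k_plus\<close>, \<open>k_minus\<close>) add up to \<open>k\<close>. This is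
  Bobylev's formula (\<open>fourier_gain\<close>).

  Transforms of probability measures are bounded by \<open>1\<close>, so for two measures \<open>f\<close> and \<open>g\<close> the
  products differ by at most \<open>d (|k\<^sup>+|\<^sup>s + |k\<^sup>-|\<^sup>s)\<close>, where \<open>s = 2 + \<alpha>\<close> and \<open>d\<close> is the Fourier distance of order \<open>s\<close>
  (\<open>fourier_product_diff_le\<close>). It remains to average the right-hand side. The cosine of the angle between \<open>k\<close> and a
  uniformly distributed \<open>\<sigma>\<close> is itself uniformly distributed, by Archimedes' hat-box
  theorem (\<open>nn_integral_sphere_height\<close>), and \<open>|k\<^sup>+|\<^sup>2\<close> and \<open>|k\<^sup>-|\<^sup>2\<close> are affine in this cosine.
  The averages are therefore elementary integrals, and their sum is exactly \<open>|k|\<^sup>s\<close> times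
  \<open>2 / (4 + \<alpha>)\<close> times the integrand of the contraction constant
  (\<open>nn_integral_sphere_contraction_rate\<close>). Dividing by \<open>|k|\<^sup>s\<close> and taking the supremum gives the theorem.

  The constant is positive because its integrand is. If \<open>\<eta>\<close> has a finite moment of order \<open>s\<close>, the
  constant is finite: both frequencies have length at most \<open>(1 + e + \<eta>) |k|\<close>, so the integrand is bounded by a
  multiple of \<open>(1 + e + \<eta>)\<^sup>s\<close>.
\<close>

section \<open>The surface measure of the sphere\<close>

lemma emeasure_sphere_measure_cone:
  fixes A :: "'a::euclidean_space set"
  assumes "A \<in> sets (restrict_space borel (sphere 0 1))"
  shows "emeasure sphere_measure A
    = ennreal (real DIM('a)) * emeasure lborel (sgn -` A \<inter> (ball 0 1 - {0}))"
proof -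
  have "emeasure sphere_measure A = ennreal (real DIM('a)) *
      emeasure (restrict_space lborel (ball 0 1 - {0})) (sgn -` A \<inter> (ball 0 1 - {0}))"
    using assms unfolding sphere_measure_def
    by (subst emeasure_scale_measure, subst emeasure_distr[OF sgn_measurable_sphere])
       (auto simp: space_restrict_space)
  also have "\<dots> = ennreal (real DIM('a)) * emeasure lborel (sgn -` A \<inter> (ball 0 1 - {0}))"
    by (subst emeasure_restrict_space) auto
  finally show ?thesis .
qed

text \<open>The tool for computing on the sphere: a spherical integral becomes a Lebesgue integral over the
  unit ball of a function that is constant along rays, and there Fubini's theorem is available.\<close>

lemma nn_integral_sphere_measure_cone:
  fixes F :: "'a::euclidean_space \<Rightarrow> ennreal"
  assumes [measurable]: "F \<in> borel_measurable borel"
  shows "(\<integral>\<^sup>+\<sigma>. F \<sigma> \<partial>sphere_measure)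
    = ennreal (real DIM('a)) * (\<integral>\<^sup>+x. F (sgn x) * indicator (ball 0 1 - {0}) x \<partial>lborel)"
proof -
  have dens: "(sphere_measure :: 'a measure) = density
      (distr (restrict_space lborel (ball 0 1 - {0})) (restrict_space borel (sphere 0 1)) sgn)
      (\<lambda>_. ennreal (real DIM('a)))"
    unfolding sphere_measure_def
    by (rule measure_eqI) (auto simp: emeasure_density nn_integral_cmult_indicator)
  have F: "F \<in> borel_measurable (restrict_space borel (sphere 0 1))"
    by (rule measurable_restrict_space1) simp
  have "(\<integral>\<^sup>+\<sigma>. F \<sigma> \<partial>sphere_measure) = ennreal (real DIM('a)) *
      (\<integral>\<^sup>+x. F (sgn x) \<partial>restrict_space lborel (ball 0 1 - {0}))"
    unfolding dens using F
    by (simp add: nn_integral_density nn_integral_cmult nn_integral_distr[OF sgn_measurable_sphere])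
  also have "(\<integral>\<^sup>+x. F (sgn x) \<partial>restrict_space lborel (ball 0 1 - {0}))
      = (\<integral>\<^sup>+x. F (sgn x) * indicator (ball 0 1 - {0}) x \<partial>lborel)"
    by (subst nn_integral_restrict_space) auto
  finally show ?thesis .
qed

text \<open>Orthogonal transformations have determinant of absolute value one, so they preserve the volume of
  boxes, and Lebesgue measure is determined by these volumes.\<close>

lemma distr_lborel_orthogonal_transformation:
  fixes R :: "real^'n::{finite,wellorder} \<Rightarrow> real^'n::_"
  assumes R: "orthogonal_transformation R"
  shows "distr lborel borel R = lborel"
proof (rule lborel_eqI[symmetric])
  have lin: "linear R" using R orthogonal_transformation_linear by blast
  then have [measurable]: "R \<in> borel_measurable borel"
    by (intro borel_measurable_continuous_onI linear_continuous_on) (simp add: linear_linear)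
  fix l u :: "real^'n::_" assume lu: "\<And>b. b \<in> Basis \<Longrightarrow> l \<bullet> b \<le> u \<bullet> b"
  have vim: "R -` box l u = inv R ` box l u"
    using R by (simp add: bij_vimage_eq_inv_image orthogonal_transformation_bij)
  have invR: "orthogonal_transformation (inv R)" by (rule orthogonal_transformation_inv[OF R])
  have [measurable]: "R -` box l u \<in> sets borel"
    using measurable_sets[of R borel borel "box l u"] by simp
  have "emeasure (distr lborel borel R) (box l u) = emeasure lebesgue (R -` box l u)"
    by (simp add: emeasure_distr)
  also have "\<dots> = emeasure lebesgue (inv R ` box l u)" by (simp add: vim)
  also have "\<dots> = measure lebesgue (inv R ` box l u)"
    by (intro emeasure_eq_measure2 measurable_orthogonal_image[OF invR]) simp
  also have "\<dots> = measure lebesgue (box l u)"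
    by (subst measure_orthogonal_image[OF invR]) simp_all
  also have "\<dots> = emeasure lborel (box l u)"
    by (simp add: emeasure_eq_measure2 lmeasurable_box)
  also have "\<dots> = (\<Prod>b\<in>Basis. (u - l) \<bullet> b)" using lu by simp
  finally show "emeasure (distr lborel borel R) (box l u) = (\<Prod>b\<in>Basis. (u - l) \<bullet> b)" .
qed simp

lemma measurable_orthogonal_transformation_sphere:
  fixes R :: "real^'n::{finite,wellorder} \<Rightarrow> real^'n::_"
  assumes R: "orthogonal_transformation R"
  shows "R \<in> measurable sphere_measure sphere_measure"
proof -
  have "linear R" using R orthogonal_transformation_linear by blast
  then have "R \<in> borel_measurable borel"
    by (intro borel_measurable_continuous_onI linear_continuous_on) (simp add: linear_linear)
  then have "R \<in> measurable (restrict_space borel (sphere 0 1)) (restrict_space borel (sphere 0 1))"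
    using R by (intro measurable_restrict_space3) (auto simp: orthogonal_transformation_norm)
  then show ?thesis by (simp add: sphere_measure_def cong: measurable_cong_sets)
qed

text \<open>An orthogonal transformation commutes with the radial projection and maps the unit ball to
  itself, so rotation invariance passes from Lebesgue measure to the surface measure.\<close>

lemma distr_sphere_measure_orthogonal_transformation:
  fixes R :: "real^'n::{finite,wellorder} \<Rightarrow> real^'n::_"
  assumes R: "orthogonal_transformation R"
  shows "distr sphere_measure sphere_measure R = sphere_measure"
proof (rule measure_eqI)
  note mR = measurable_orthogonal_transformation_sphere[OF R]
  have lin: "linear R" using R orthogonal_transformation_linear by blast
  then have [measurable]: "R \<in> borel_measurable borel"
    by (intro borel_measurable_continuous_onI linear_continuous_on) (simp add: linear_linear)
  fix A :: "(real^'n::_) set" assume "A \<in> sets (distr sphere_measure sphere_measure R)"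
  then have A: "A \<in> sets (restrict_space borel (sphere 0 1))"
    by (simp add: sphere_measure_def)
  let ?S = "space (sphere_measure :: (real^'n::_) measure)"
  have S: "?S = sphere 0 1"
    by (auto simp: sphere_measure_def space_scale_measure space_restrict_space)
  have A': "R -` A \<inter> ?S \<in> sets (restrict_space borel (sphere 0 1))"
    using measurable_sets[OF mR, of A] A by (simp add: sphere_measure_def)
  have C: "sgn -` A \<inter> (ball 0 1 - {0}) \<in> sets borel"
    using measurable_sets[OF sgn_measurable_sphere A]
    by (simp add: space_restrict_space sets_restrict_space_iff)
  have sgnR: "sgn (R x) = R (sgn x)" for x
    using R linear_scale[OF lin] by (simp add: sgn_div_norm orthogonal_transformation_norm)
  have R0: "R x = 0 \<longleftrightarrow> x = 0" for x
    using orthogonal_transformation_norm[OF R, of x] by (metis norm_eq_zero)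
  have "emeasure (distr sphere_measure sphere_measure R) A = emeasure sphere_measure (R -` A \<inter> ?S)"
    using A by (intro emeasure_distr mR) (simp add: sphere_measure_def)
  also have "\<dots> = ennreal (real DIM(real^'n::_))
      * emeasure lborel (sgn -` (R -` A \<inter> ?S) \<inter> (ball 0 1 - {0}))"
    by (rule emeasure_sphere_measure_cone[OF A'])
  also have "sgn -` (R -` A \<inter> ?S) \<inter> (ball 0 1 - {0}) = R -` (sgn -` A \<inter> (ball 0 1 - {0}))"
    using orthogonal_transformation_norm[OF R] by (auto simp: S sgnR R0 norm_sgn)
  also have "emeasure lborel \<dots> = emeasure (distr lborel borel R) (sgn -` A \<inter> (ball 0 1 - {0}))"
    using C by (simp add: emeasure_distr)
  also have "\<dots> = emeasure lborel (sgn -` A \<inter> (ball 0 1 - {0}))"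
    by (simp add: distr_lborel_orthogonal_transformation[OF R])
  also have "ennreal (real DIM(real^'n::_)) * \<dots> = emeasure sphere_measure A"
    by (rule emeasure_sphere_measure_cone[OF A, symmetric])
  finally show "emeasure (distr sphere_measure sphere_measure R) A = emeasure sphere_measure A" .
qed simp

text \<open>The geometric fact behind Bobylev's formula: the average of a function of \<open>|a| (\<sigma> \<bullet> b)\<close> depends on
  \<open>a\<close> and \<open>b\<close> only through the product of their norms, so the vector that is projected on \<open>\<sigma>\<close> and
  the vector that only contributes its length can trade places.\<close>

lemma integral_sphere_swap:
  fixes a b :: "real^'n::{finite,wellorder}" and F :: "real \<Rightarrow> real"
  assumes [measurable]: "F \<in> borel_measurable borel"
  shows "(\<integral>\<sigma>. F (norm a * (\<sigma> \<bullet> b)) \<partial>sphere_measure) = (\<integral>\<sigma>. F (norm b * (\<sigma> \<bullet> a)) \<partial>sphere_measure)"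
proof -
  \<comment> \<open>both vectors have norm \<open>|a| |b|\<close>\<close>
  obtain R where R: "orthogonal_transformation R" and Rb: "R (norm a *\<^sub>R b) = norm b *\<^sub>R a"
    using orthogonal_transformation_exists[of "norm a *\<^sub>R b" "norm b *\<^sub>R a"] by auto
  have "F \<circ> (\<lambda>\<sigma>. norm b * (\<sigma> \<bullet> a)) \<in> borel_measurable (restrict_space borel (sphere 0 1))"
    by (rule measurable_restrict_space1) measurable
  then have m: "(\<lambda>\<sigma>. F (norm b * (\<sigma> \<bullet> a))) \<in> borel_measurable sphere_measure"
    by (simp add: sphere_measure_def o_def cong: measurable_cong_sets)
  have "norm a * (\<sigma> \<bullet> b) = norm b * (R \<sigma> \<bullet> a)" for \<sigma>
  proof -
    have "\<sigma> \<bullet> (norm a *\<^sub>R b) = R \<sigma> \<bullet> R (norm a *\<^sub>R b)"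
      using R by (simp add: orthogonal_transformation_def)
    then show ?thesis by (simp add: Rb)
  qed
  then have "(\<integral>\<sigma>. F (norm a * (\<sigma> \<bullet> b)) \<partial>sphere_measure)
      = (\<integral>\<sigma>. F (norm b * (R \<sigma> \<bullet> a)) \<partial>sphere_measure)" by simp
  also have "\<dots> = (\<integral>\<sigma>. F (norm b * (\<sigma> \<bullet> a)) \<partial>distr sphere_measure sphere_measure R)"
    by (rule integral_distr[OF measurable_orthogonal_transformation_sphere[OF R] m, symmetric])
  also have "\<dots> = (\<integral>\<sigma>. F (norm b * (\<sigma> \<bullet> a)) \<partial>sphere_measure)"
    by (simp add: distr_sphere_measure_orthogonal_transformation[OF R])
  finally show ?thesis .
qed

section \<open>Heights on the sphere are uniformly distributed\<close>

lemma borel_measurable_cylinder: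
  "(\<lambda>(z, y::real^2). vector [y $ 1, y $ 2, z] :: real^3) \<in> borel_measurable borel"
    (is "?T \<in> _")
proof (intro borel_measurable_continuous_onI)
  have "?T = (\<lambda>p. snd p $ 1 *\<^sub>R axis 1 1 + snd p $ 2 *\<^sub>R axis 2 1 + fst p *\<^sub>R axis 3 1)"
    by (auto simp: fun_eq_iff vec_eq_iff forall_3 axis_def)
  then show "continuous_on UNIV ?T" by (simp add: continuous_intros)
qed

text \<open>Lebesgue measure on space is the product of the vertical axis and the horizontal plane, which is stated
  as a push-forward because \<open>real^3\<close> is not a product type.\<close>

lemma distr_lborel_cylinder:
  "distr (lborel :: (real \<times> (real^2)) measure) borel (\<lambda>(z, y::real^2). vector [y $ 1, y $ 2, z] :: real^3) = lborel"
proof (rule lborel_eqI[symmetric])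
  let ?T = "\<lambda>(z, y::real^2). vector [y $ 1, y $ 2, z] :: real^3"
  have Basis: "Basis = range (\<lambda>i::'n::finite. axis i (1::real))"
    by (auto simp: Basis_vec_def)
  have prodB: "(\<Prod>b\<in>Basis. x \<bullet> b) = (\<Prod>i\<in>UNIV. x $ i)" for x :: "real^'n::finite"
    unfolding Basis by (subst prod.reindex) (auto simp: inj_on_def axis_eq_axis inner_axis)
  note [measurable] = borel_measurable_cylinder
  fix l u :: "real^3" assume lu: "\<And>b. b \<in> Basis \<Longrightarrow> l \<bullet> b \<le> u \<bullet> b"
  have le: "l $ i \<le> u $ i" for i using lu[of "axis i 1"] by (simp add: Basis inner_axis)
  have "?T -` box l u = box (l $ 3) (u $ 3) \<times> box (vector [l $ 1, l $ 2]) (vector [u $ 1, u $ 2])"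
    by (auto simp: box_def Basis inner_axis forall_3 forall_2)
  then have "emeasure (distr lborel borel ?T) (box l u) = emeasure (lborel \<Otimes>\<^sub>M lborel)
     (box (l $ 3) (u $ 3) \<times> box (vector [l $ 1, l $ 2]) (vector [u $ 1, u $ 2] :: real^2))"
    by (simp add: emeasure_distr lborel_prod)
  also have "\<dots> = emeasure lborel (box (l $ 3) (u $ 3)) *
      emeasure lborel (box (vector [l $ 1, l $ 2]) (vector [u $ 1, u $ 2] :: real^2))"
    by (rule lborel.emeasure_pair_measure_Times) auto
  also have "emeasure lborel (box (vector [l $ 1, l $ 2]) (vector [u $ 1, u $ 2] :: real^2))
      = ennreal ((u $ 1 - l $ 1) * (u $ 2 - l $ 2))"
  proof -
    have "emeasure lborel (box a b) = ennreal (\<Prod>i\<in>UNIV. (b - a) $ i)"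
      if "\<forall>i. a $ i \<le> b $ i" for a b :: "real^2"
      unfolding prodB[symmetric] using that by (intro emeasure_lborel_box) (auto simp: Basis inner_axis)
    from this[of "vector [l $ 1, l $ 2]" "vector [u $ 1, u $ 2]"] show ?thesis
      using le by (simp add: forall_2 UNIV_2)
  qed
  also have "emeasure lborel (box (l $ 3) (u $ 3)) = ennreal (u $ 3 - l $ 3)"
    using le[of 3] by simp
  also have "ennreal (u $ 3 - l $ 3) * ennreal ((u $ 1 - l $ 1) * (u $ 2 - l $ 2))
      = ennreal (\<Prod>b\<in>Basis. (u - l) \<bullet> b)"
  proof -
    have "(\<Prod>i\<in>UNIV. x $ i) = x $ 3 * (x $ 1 * x $ 2)" for x :: "real^3"
      unfolding UNIV_3 by (simp add: mult_ac)
    then have "(\<Prod>b\<in>Basis. (u - l) \<bullet> b) = (u $ 3 - l $ 3) * ((u $ 1 - l $ 1) * (u $ 2 - l $ 2))"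
      unfolding prodB by (simp only: vector_minus_component)
    then show ?thesis using le[of 1] le[of 2] le[of 3] by (simp add: ennreal_mult)
  qed
  finally show "emeasure (distr lborel borel ?T) (box l u) = (\<Prod>b\<in>Basis. (u - l) \<bullet> b)" .
qed simp

lemma nn_integral_cylinder:
  fixes h :: "real^3 \<Rightarrow> ennreal"
  assumes [measurable]: "h \<in> borel_measurable borel"
  shows "(\<integral>\<^sup>+x. h x \<partial>lborel) = (\<integral>\<^sup>+z. \<integral>\<^sup>+y. h (vector [(y::real^2) $ 1, y $ 2, z]) \<partial>lborel \<partial>lborel)"
proof -
  let ?T = "\<lambda>(z, y::real^2). vector [y $ 1, y $ 2, z] :: real^3"
  note [measurable] = borel_measurable_cylinder
  have T: "?T \<in> borel_measurable (lborel \<Otimes>\<^sub>M lborel)"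
    by (simp add: lborel_prod)
  have "(\<integral>\<^sup>+x. h x \<partial>lborel) = (\<integral>\<^sup>+p. h (?T p) \<partial>(lborel \<Otimes>\<^sub>M lborel))"
    by (subst distr_lborel_cylinder[symmetric]) (simp add: nn_integral_distr lborel_prod)
  also have "\<dots> = (\<integral>\<^sup>+z. \<integral>\<^sup>+y. h (?T (z, y)) \<partial>lborel \<partial>lborel)"
    by (rule lborel.nn_integral_fst[symmetric]) (rule measurable_compose[OF T], measurable)
  finally show ?thesis by simp
qed

lemma nn_integral_linear_interval:
  assumes "0 \<le> m" "m \<le> 1"
  shows "(\<integral>\<^sup>+s. ennreal (2 * pi * s) * indicator {m<..<1} s \<partial>lborel) = ennreal (pi * (1 - m\<^sup>2))"
proof -
  have "((\<lambda>s. 2 * pi * s) has_integral pi * 1\<^sup>2 - pi * m\<^sup>2) {m..1}"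
    using assms by (intro fundamental_theorem_of_calculus)
      (auto intro!: derivative_eq_intros simp: has_real_derivative_iff_has_vector_derivative[symmetric])
  then have "((\<lambda>s. 2 * pi * s) has_integral pi * (1 - m\<^sup>2)) {m<..<1}"
    by (simp add: has_integral_Icc_iff_Ioo algebra_simps)
  from nn_integral_has_integral_lebesgue[OF _ this] assms show ?thesis
    by (simp add: ennreal_mult' ennreal_indicator mult.commute)
qed

text \<open>At height \<open>z\<close>, the points at distance less than \<open>s\<close> from the origin form a disc of area
  \<open>\<pi> (s\<^sup>2 - z\<^sup>2)\<close>. Differentiating in \<open>s\<close> gives the density \<open>2 \<pi> s\<close> of the distance, and \<open>z\<close>
  survives only as the lower end point \<open>|z|\<close> of the range of distances. The restriction to
  distances below \<open>1\<close> cuts out the unit ball and makes the measures finite.\<close>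

lemma distr_lborel_dist_axis:
  fixes z :: real
  defines "\<rho> \<equiv> \<lambda>y::real^2. sqrt (z\<^sup>2 + (norm y)\<^sup>2)"
  shows "distr (restrict_space lborel {y. \<rho> y < 1}) borel \<rho>
    = density lborel (\<lambda>s. ennreal (2 * pi * s) * indicator {\<bar>z\<bar><..<1} s)"
proof (rule measure_eqI_lessThan)
  have [measurable]: "\<rho> \<in> borel_measurable borel" unfolding \<rho>_def by measurable
  have m\<rho>: "\<rho> \<in> borel_measurable (restrict_space lborel {y. \<rho> y < 1})"
    by (rule measurable_restrict_space1) simp
  have \<rho>_less: "\<rho> y < s \<longleftrightarrow> norm y < sqrt (s\<^sup>2 - z\<^sup>2)" if "\<bar>z\<bar> \<le> s" for s y
  proof -
    have "\<rho> y < s \<longleftrightarrow> z\<^sup>2 + (norm y)\<^sup>2 < s\<^sup>2"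
      using that unfolding \<rho>_def by (metis abs_ge_zero abs_of_nonneg order_trans real_sqrt_abs real_sqrt_less_iff)
    also have "\<dots> \<longleftrightarrow> norm y < sqrt (s\<^sup>2 - z\<^sup>2)"
      by (metis less_diff_eq add.commute norm_ge_zero real_sqrt_abs abs_of_nonneg real_sqrt_less_iff)
    finally show ?thesis .
  qed
  have \<rho>_gt: "s < \<rho> y \<longleftrightarrow> sqrt (s\<^sup>2 - z\<^sup>2) < norm y" if "\<bar>z\<bar> \<le> s" for s y
  proof -
    have "s < \<rho> y \<longleftrightarrow> s\<^sup>2 < z\<^sup>2 + (norm y)\<^sup>2"
      using that unfolding \<rho>_def by (metis abs_ge_zero abs_of_nonneg order_trans real_sqrt_abs real_sqrt_less_iff)
    also have "\<dots> \<longleftrightarrow> sqrt (s\<^sup>2 - z\<^sup>2) < norm y"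
      by (metis diff_less_eq add.commute norm_ge_zero real_sqrt_abs abs_of_nonneg real_sqrt_less_iff)
    finally show ?thesis .
  qed
  have \<rho>_ge: "\<bar>z\<bar> \<le> \<rho> y" for y
    unfolding \<rho>_def by (simp add: real_le_rsqrt)
  have area: "emeasure lborel (ball (0::real^2) (sqrt (s\<^sup>2 - z\<^sup>2))) = ennreal (pi * (s\<^sup>2 - z\<^sup>2))"
    and carea: "emeasure lborel (cball (0::real^2) (sqrt (s\<^sup>2 - z\<^sup>2))) = ennreal (pi * (s\<^sup>2 - z\<^sup>2))"
    if "\<bar>z\<bar> \<le> s" for s
  proof -
    have "z\<^sup>2 \<le> s\<^sup>2" using that by (metis abs_le_square_iff abs_of_nonneg abs_ge_zero order_trans)
    then show "emeasure lborel (ball (0::real^2) (sqrt (s\<^sup>2 - z\<^sup>2))) = ennreal (pi * (s\<^sup>2 - z\<^sup>2))"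
      and "emeasure lborel (cball (0::real^2) (sqrt (s\<^sup>2 - z\<^sup>2))) = ennreal (pi * (s\<^sup>2 - z\<^sup>2))"
      by (simp_all add: emeasure_ball emeasure_cball unit_ball_vol_2)
  qed
  let ?M = "distr (restrict_space lborel {y. \<rho> y < 1}) borel \<rho>"
  let ?N = "density lborel (\<lambda>s. ennreal (2 * pi * s) * indicator {\<bar>z\<bar><..<1} s)"
  have eM: "emeasure ?M {a<..} = emeasure lborel {y. a < \<rho> y \<and> \<rho> y < 1}" for a
  proof -
    have "emeasure ?M {a<..} = emeasure (restrict_space lborel {y. \<rho> y < 1}) (\<rho> -` {a<..} \<inter> {y. \<rho> y < 1})"
      by (subst emeasure_distr[OF m\<rho>]) (auto simp: space_restrict_space)
    also have "\<dots> = emeasure lborel (\<rho> -` {a<..} \<inter> {y. \<rho> y < 1})"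
      by (rule emeasure_restrict_space) auto
    also have "\<rho> -` {a<..} \<inter> {y. \<rho> y < 1} = {y. a < \<rho> y \<and> \<rho> y < 1}" by auto
    finally show ?thesis .
  qed
  have eN: "emeasure ?N {a<..} = (\<integral>\<^sup>+s. ennreal (2 * pi * s) * indicator {max a \<bar>z\<bar><..<1} s \<partial>lborel)" for a
    by (subst emeasure_density) (auto intro!: nn_integral_cong split: split_indicator)
  show eq: "emeasure ?M {a<..} = emeasure ?N {a<..}" for a
  proof -
    consider "max a \<bar>z\<bar> \<ge> 1" | "a < \<bar>z\<bar>" "\<bar>z\<bar> < 1" | "\<bar>z\<bar> \<le> a" "a < 1" by linarith
    then show ?thesis
    proof cases
      case 1
      then have "\<not> (a < \<rho> y \<and> \<rho> y < 1)" for y using \<rho>_ge[of y] by linarith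
      then have E: "{y. a < \<rho> y \<and> \<rho> y < 1} = {}" by blast
      have E': "{max a \<bar>z\<bar><..<1} = {}" using 1 by auto
      show ?thesis unfolding eM eN E E' by simp
    next
      case 2
      have "a < \<rho> y" for y using 2 \<rho>_ge[of y] by linarith
      then have "{y. a < \<rho> y \<and> \<rho> y < 1} = ball 0 (sqrt (1\<^sup>2 - z\<^sup>2))"
        using 2 \<rho>_less[of 1] by auto
      then show ?thesis
        unfolding eM eN using 2 area[of 1] by (simp add: nn_integral_linear_interval max_def)
    next
      case 3
      have "{y. a < \<rho> y \<and> \<rho> y < 1} = ball 0 (sqrt (1\<^sup>2 - z\<^sup>2)) - cball 0 (sqrt (a\<^sup>2 - z\<^sup>2))"
        using 3 \<rho>_less[of 1] \<rho>_gt[of a] by (auto simp: not_le)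
      moreover have "cball 0 (sqrt (a\<^sup>2 - z\<^sup>2)) \<subseteq> ball (0::real^2) (sqrt (1\<^sup>2 - z\<^sup>2))"
      proof -
        have "a\<^sup>2 < 1" using 3 by (simp add: abs_square_less_1)
        then have "sqrt (a\<^sup>2 - z\<^sup>2) < sqrt (1\<^sup>2 - z\<^sup>2)" by simp
        then show ?thesis by (simp add: cball_subset_ball_iff)
      qed
      ultimately have "emeasure ?M {a<..} = ennreal (pi * (1 - z\<^sup>2)) - ennreal (pi * (a\<^sup>2 - z\<^sup>2))"
        unfolding eM using 3 area[of 1] carea[of a] by (simp add: emeasure_Diff)
      also have "\<dots> = ennreal (pi * (1 - a\<^sup>2))"
      proof -
        have "z\<^sup>2 \<le> a\<^sup>2" using 3 abs_le_square_iff[of z a] by simp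
        then show ?thesis by (subst ennreal_minus) (auto simp: algebra_simps)
      qed
      also have "\<dots> = emeasure ?N {a<..}"
        unfolding eN using 3 by (subst nn_integral_linear_interval) (auto simp: max_def)
      finally show ?thesis .
    qed
  qed
  show "emeasure ?M {a<..} < \<infinity>" for a
  proof -
    have "norm y \<le> 1" if "\<rho> y < 1" for y
      using real_sqrt_sum_squares_ge2[of "norm y" z] that unfolding \<rho>_def by linarith
    then have "{y. a < \<rho> y \<and> \<rho> y < 1} \<subseteq> cball 0 1" by auto
    then have "emeasure lborel {y. a < \<rho> y \<and> \<rho> y < 1} \<le> emeasure lborel (cball (0::real^2) 1)"
      by (intro emeasure_mono) auto
    also have "\<dots> < \<infinity>" by (simp add: emeasure_cball)
    finally show ?thesis unfolding eM .
  qed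
qed simp_all

text \<open>Archimedes' hat-box theorem: the height of a uniformly distributed point of the sphere is uniformly
  distributed. In the unit ball, write a point through its height \<open>z\<close> and its distance \<open>s\<close> from the
  origin. The density of \<open>(z, s)\<close> on \<open>|z| < s < 1\<close> is \<open>2 \<pi> s\<close>, which does not depend on \<open>z\<close>; hence for
  given \<open>s\<close> the quotient \<open>z / s\<close>, which is the height of the radial projection, is uniform on
  the interval from \<open>-1\<close> to \<open>1\<close>.\<close>

lemma nn_integral_sphere_height_axis:
  fixes F :: "real \<Rightarrow> ennreal"
  assumes [measurable]: "F \<in> borel_measurable borel"
  shows "(\<integral>\<^sup>+\<sigma>. F (\<sigma> \<bullet> axis 3 1) \<partial>(sphere_measure :: (real^3) measure))
    = ennreal (2 * pi) * (\<integral>\<^sup>+t. F t * indicator {-1<..<1} t \<partial>lborel)"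
proof -
  define \<rho> where "\<rho> z y = sqrt (z\<^sup>2 + (norm y)\<^sup>2)" for z :: real and y :: "real^2"
  define I where "I = (\<integral>\<^sup>+t. F t * indicator {-1<..<1} t \<partial>lborel)"
  have [measurable]: "\<rho> z \<in> borel_measurable borel" for z unfolding \<rho>_def by measurable
  have norm_vec: "norm (vector [y $ 1, y $ 2, z] :: real^3) = \<rho> z y" for y z
    by (simp add: \<rho>_def norm_vec_def L2_set_def sum_2 sum_3 power2_eq_square add_ac)
  have m: "(\<lambda>x::real^3. F (sgn x \<bullet> axis 3 1) * indicator (ball 0 1 - {0}) x) \<in> borel_measurable borel"
    by (rule borel_measurable_times_ennreal[OF _ borel_measurable_indicator]) (measurable, auto)
  have "(\<integral>\<^sup>+\<sigma>. F (\<sigma> \<bullet> axis 3 1) \<partial>(sphere_measure :: (real^3) measure))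
     = 3 * (\<integral>\<^sup>+x. F (sgn x \<bullet> axis 3 1) * indicator (ball 0 1 - {0}) x \<partial>(lborel :: (real^3) measure))"
    by (subst nn_integral_sphere_measure_cone) auto
  also have "(\<integral>\<^sup>+x. F (sgn x \<bullet> axis 3 1) * indicator (ball 0 1 - {0}) x \<partial>(lborel :: (real^3) measure))
    = (\<integral>\<^sup>+z. \<integral>\<^sup>+y. F (z / \<rho> z y) * indicator {0<..} (\<rho> z y) * indicator {y. \<rho> z y < 1} y \<partial>lborel \<partial>lborel)"
  proof (subst nn_integral_cylinder[OF m], intro nn_integral_cong)
    fix z :: real and y :: "real^2"
    let ?x = "vector [y $ 1, y $ 2, z] :: real^3"
    have "sgn ?x \<bullet> axis 3 1 = z / \<rho> z y"
      by (simp add: sgn_div_norm norm_vec inner_axis divide_inverse)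
    moreover have "?x = 0 \<longleftrightarrow> \<rho> z y = 0" by (metis norm_vec norm_eq_zero)
    moreover have "\<rho> z y \<ge> 0" by (simp add: \<rho>_def)
    ultimately show "F (sgn ?x \<bullet> axis 3 1) * indicator (ball 0 1 - {0}) ?x
      = F (z / \<rho> z y) * indicator {0<..} (\<rho> z y) * indicator {y. \<rho> z y < 1} y"
      by (auto simp: norm_vec split: split_indicator)
  qed
  \<comment> \<open>in each horizontal plane, integrate over the distance \<open>s\<close> from the origin\<close>
  also have "\<dots> = (\<integral>\<^sup>+z. \<integral>\<^sup>+s. ennreal (2 * pi * s) * indicator {\<bar>z\<bar><..<1} s * F (z / s) \<partial>lborel \<partial>lborel)"
  proof (intro nn_integral_cong)
    fix z :: real
    have "(\<integral>\<^sup>+y. F (z / \<rho> z y) * indicator {0<..} (\<rho> z y) * indicator {y. \<rho> z y < 1} y \<partial>lborel)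
        = (\<integral>\<^sup>+y. F (z / \<rho> z y) * indicator {0<..} (\<rho> z y) \<partial>restrict_space lborel {y. \<rho> z y < 1})"
      by (subst nn_integral_restrict_space) auto
    also have "\<dots> = (\<integral>\<^sup>+s. F (z / s) * indicator {0<..} s
        \<partial>distr (restrict_space lborel {y. \<rho> z y < 1}) borel (\<rho> z))"
      by (rule nn_integral_distr[symmetric]) (auto intro!: measurable_restrict_space1)
    also have "\<dots> = (\<integral>\<^sup>+s. F (z / s) * indicator {0<..} s
        \<partial>density lborel (\<lambda>s. ennreal (2 * pi * s) * indicator {\<bar>z\<bar><..<1} s))"
      unfolding \<rho>_def distr_lborel_dist_axis ..
    also have "\<dots> = (\<integral>\<^sup>+s. ennreal (2 * pi * s) * indicator {\<bar>z\<bar><..<1} s * F (z / s) \<partial>lborel)"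
      by (subst nn_integral_density) (auto intro!: nn_integral_cong split: split_indicator)
    finally show "(\<integral>\<^sup>+y. F (z / \<rho> z y) * indicator {0<..} (\<rho> z y) * indicator {y. \<rho> z y < 1} y \<partial>lborel)
      = (\<integral>\<^sup>+s. ennreal (2 * pi * s) * indicator {\<bar>z\<bar><..<1} s * F (z / s) \<partial>lborel)" .
  qed
  also have "\<dots> = (\<integral>\<^sup>+s. \<integral>\<^sup>+z. ennreal (2 * pi * s) * indicator {\<bar>z\<bar><..<1} s * F (z / s) \<partial>lborel \<partial>lborel)"
  proof (rule lborel_pair.Fubini')
    have "(\<lambda>(s, z). ennreal (2 * pi * s) * indicator {\<bar>z\<bar><..<1} s * F (z / s))
        = (\<lambda>x. ennreal (2 * pi * fst x) * indicator {x. \<bar>snd x\<bar> < fst x \<and> fst x < 1} x * F (snd x / fst x))"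
      by (auto simp: fun_eq_iff split: split_indicator)
    also have "\<dots> \<in> borel_measurable (borel \<Otimes>\<^sub>M borel)" by measurable
    finally show "(\<lambda>(s, z). ennreal (2 * pi * s) * indicator {\<bar>z\<bar><..<1} s * F (z / s))
        \<in> borel_measurable (lborel \<Otimes>\<^sub>M lborel)"
      by (simp add: measurable_cong_sets[OF sets_pair_measure_cong[OF sets_lborel sets_lborel] refl])
  qed
  \<comment> \<open>substitute \<open>z = s t\<close>, which separates the variables\<close>
  also have "\<dots> = (\<integral>\<^sup>+s. I * (ennreal (2 * pi * s\<^sup>2) * indicator {0<..<1} s) \<partial>lborel)"
  proof (intro nn_integral_cong)
    fix s :: real
    show "(\<integral>\<^sup>+z. ennreal (2 * pi * s) * indicator {\<bar>z\<bar><..<1} s * F (z / s) \<partial>lborel)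
      = I * (ennreal (2 * pi * s\<^sup>2) * indicator {0<..<1} s)"
    proof (cases "s \<in> {0<..<1}")
      case True
      have "(\<integral>\<^sup>+z. ennreal (2 * pi * s) * indicator {\<bar>z\<bar><..<1} s * F (z / s) \<partial>lborel)
        = (\<integral>\<^sup>+z. ennreal (2 * pi * s) * (indicator {-s<..<s} z * F (z / s)) \<partial>lborel)"
        using True by (intro nn_integral_cong) (auto split: split_indicator)
      also have "\<dots> = ennreal (2 * pi * s) * (\<integral>\<^sup>+z. indicator {-s<..<s} z * F (z / s) \<partial>lborel)"
        by (rule nn_integral_cmult) measurable
      also have "(\<integral>\<^sup>+z. indicator {-s<..<s} z * F (z / s) \<partial>lborel)
        = ennreal s * (\<integral>\<^sup>+t. indicator {-s<..<s} (0 + s * t) * F ((0 + s * t) / s) \<partial>lborel)"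
        using True by (subst nn_integral_real_affine[where c = s and t = 0]) auto
      also have "(\<integral>\<^sup>+t. indicator {-s<..<s} (0 + s * t) * F ((0 + s * t) / s) \<partial>lborel) = I"
        unfolding I_def
      proof (intro nn_integral_cong)
        fix t
        have "s * t \<in> {-s<..<s} \<longleftrightarrow> t \<in> {-1<..<1}"
          using True mult_less_cancel_left_pos[of s "-1" t] mult_less_cancel_left_pos[of s t 1] by auto
        then show "indicator {-s<..<s} (0 + s * t) * F ((0 + s * t) / s) = F t * indicator {-1<..<1} t"
          using True by (auto split: split_indicator)
      qed
      also have "ennreal (2 * pi * s) * (ennreal s * I) = I * (ennreal (2 * pi * s\<^sup>2) * indicator {0<..<1} s)"
        using True by (simp add: ennreal_mult[symmetric] mult.assoc[symmetric] power2_eq_square mult.commute[of I])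
      finally show ?thesis .
    next
      case False
      then have "ennreal (2 * pi * s) * indicator {\<bar>z\<bar><..<1} s = 0" for z
        by (auto split: split_indicator simp: ennreal_neg)
      with False show ?thesis by simp
    qed
  qed
  also have "\<dots> = I * (\<integral>\<^sup>+s. ennreal (2 * pi * s\<^sup>2) * indicator {0<..<1} s \<partial>lborel)"
    by (rule nn_integral_cmult) measurable
  also have "(\<integral>\<^sup>+s. ennreal (2 * pi * s\<^sup>2) * indicator {0<..<1} s \<partial>lborel) = ennreal (2 * pi / 3)"
  proof -
    have "((\<lambda>s::real. 2 * pi * s\<^sup>2) has_integral 2 * pi * 1^3 / 3 - 2 * pi * 0^3 / 3) {0..1}"
      by (intro fundamental_theorem_of_calculus)
        (auto intro!: derivative_eq_intros simp: has_real_derivative_iff_has_vector_derivative[symmetric])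
    then have "((\<lambda>s::real. 2 * pi * s\<^sup>2) has_integral 2 * pi / 3) {0<..<1}"
      by (simp add: has_integral_Icc_iff_Ioo)
    from nn_integral_has_integral_lebesgue[OF _ this] show ?thesis
      by (simp add: ennreal_mult' ennreal_indicator mult.commute)
  qed
  also have "3 * (I * ennreal (2 * pi / 3)) = ennreal (2 * pi) * I"
  proof -
    have "3 * ennreal (2 * pi / 3) = ennreal (3 * (2 * pi / 3))"
      by (subst ennreal_mult) auto
    then show ?thesis by (simp add: mult_ac)
  qed
  finally show ?thesis unfolding I_def .
qed

lemma nn_integral_sphere_height:
  fixes F :: "real \<Rightarrow> ennreal" and n :: "real^3"
  assumes [measurable]: "F \<in> borel_measurable borel" and n: "norm n = 1"
  shows "(\<integral>\<^sup>+\<sigma>. F (\<sigma> \<bullet> n) \<partial>sphere_measure)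
    = ennreal (2 * pi) * (\<integral>\<^sup>+t. F t * indicator {-1<..<1} t \<partial>lborel)"
proof -
  have "norm n = norm (axis 3 1 :: real^3)" using n by (simp add: norm_axis_1)
  then obtain R where R: "orthogonal_transformation R" and Rn: "R n = (axis 3 1 :: real^3)"
    by (rule orthogonal_transformation_exists)
  have "F \<circ> (\<lambda>\<sigma>. \<sigma> \<bullet> axis 3 1) \<in> borel_measurable (restrict_space borel (sphere 0 1 :: (real^3) set))"
    by (rule measurable_restrict_space1) measurable
  then have m: "(\<lambda>\<sigma>. F (\<sigma> \<bullet> axis 3 1)) \<in> borel_measurable (sphere_measure :: (real^3) measure)"
    by (simp add: sphere_measure_def o_def cong: measurable_cong_sets)
  have "\<sigma> \<bullet> n = R \<sigma> \<bullet> axis 3 1" for \<sigma>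
    using R by (simp add: orthogonal_transformation_def flip: Rn)
  then have "(\<integral>\<^sup>+\<sigma>. F (\<sigma> \<bullet> n) \<partial>sphere_measure) = (\<integral>\<^sup>+\<sigma>. F (R \<sigma> \<bullet> axis 3 1) \<partial>sphere_measure)"
    by simp
  also have "\<dots> = (\<integral>\<^sup>+\<sigma>. F (\<sigma> \<bullet> axis 3 1) \<partial>distr sphere_measure sphere_measure R)"
    using m by (intro nn_integral_distr[symmetric] measurable_orthogonal_transformation_sphere[OF R]) simp
  also have "\<dots> = ennreal (2 * pi) * (\<integral>\<^sup>+t. F t * indicator {-1<..<1} t \<partial>lborel)"
    by (simp add: distr_sphere_measure_orthogonal_transformation[OF R] nn_integral_sphere_height_axis)
  finally show ?thesis .
qed

section \<open>The Fourier transform of the gain operator\<close>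

lemma finite_measure_sphere_measure: "finite_measure (sphere_measure :: (real^3) measure)"
  by (rule finite_measureI) (simp add: space_sphere_measure emeasure_sphere_measure)

lemma measurable_sphere_measure_ident:
  "(\<lambda>\<sigma>. \<sigma>) \<in> borel_measurable (sphere_measure :: (real^3) measure)"
  unfolding measurable_cong_sets[OF sets_sphere_measure refl] by (rule measurable_restrict_space1) simp

text \<open>The two frequencies of Bobylev's formula. They add up to \<open>k\<close>, and \<open>k_minus et k \<sigma>\<close> vanishes
  when \<open>\<sigma>\<close> points in the direction of \<open>k\<close>.\<close>

definition k_plus :: "real \<Rightarrow> real^3 \<Rightarrow> real^3 \<Rightarrow> real^3"
  where "k_plus et k \<sigma> = ((3 - et) / 4) *\<^sub>R k + ((1 + et) / 4 * norm k) *\<^sub>R \<sigma>"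

definition k_minus :: "real \<Rightarrow> real^3 \<Rightarrow> real^3 \<Rightarrow> real^3"
  where "k_minus et k \<sigma> = ((1 + et) / 4) *\<^sub>R k - ((1 + et) / 4 * norm k) *\<^sub>R \<sigma>"

lemma measurable_k_plus [measurable (raw)]:
  assumes [measurable]: "g \<in> borel_measurable M" "h \<in> borel_measurable M"
  shows "(\<lambda>x. k_plus (g x) k (h x)) \<in> borel_measurable M"
  unfolding k_plus_def by measurable

lemma measurable_k_minus [measurable (raw)]:
  assumes [measurable]: "g \<in> borel_measurable M" "h \<in> borel_measurable M"
  shows "(\<lambda>x. k_minus (g x) k (h x)) \<in> borel_measurable M"
  unfolding k_minus_def by measurable

lemma fourier_eq_cis: "fourier f k = (\<integral>v. cis (- (v \<bullet> k)) \<partial>f)"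
  by (simp add: fourier_def cis_conv_exp)

lemma borel_measurable_cis: "cis \<in> borel_measurable borel"
  by (intro borel_measurable_continuous_onI continuous_intros)

lemma measurable_cis [measurable (raw)]:
  "g \<in> borel_measurable M \<Longrightarrow> (\<lambda>x. cis (g x)) \<in> borel_measurable M"
  by (rule measurable_compose[OF _ borel_measurable_cis])

context
  fixes f :: "(real^3) measure"
  assumes f: "prob_space f" "sets f = sets borel"
begin

interpretation f: prob_space f by (rule f(1))

lemmas [measurable_cong] = f(2)

lemma integrable_cis: "g \<in> borel_measurable f \<Longrightarrow> integrable f (\<lambda>v. cis (g v))"
  by (rule f.integrable_const_bound[where B = 1]) auto

lemma integrable_mult_cis_inner: "integrable f (\<lambda>v. c * cis (- (v \<bullet> k)))"
proof (rule integrable_mult_right, rule integrable_cis)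
  show "(\<lambda>v. - (v \<bullet> k)) \<in> borel_measurable f" by measurable
qed

lemma measurable_fourier: "fourier f \<in> borel_measurable borel"
proof -
  have "(\<lambda>k. \<integral>v. cis (- (v \<bullet> k)) \<partial>f) \<in> borel_measurable borel"
    by (rule f.borel_measurable_lebesgue_integral) measurable
  then show ?thesis by (simp add: fourier_eq_cis[abs_def])
qed

lemma norm_fourier_le_1: "cmod (fourier f k) \<le> 1"
proof -
  have "cmod (fourier f k) \<le> (\<integral>v. cmod (cis (- (v \<bullet> k))) \<partial>f)"
    unfolding fourier_eq_cis by (rule integral_norm_bound)
  then show ?thesis by (simp add: f.prob_space)
qed

lemma fourier_0: "fourier f 0 = 1"
  by (simp add: fourier_eq_cis f.prob_space)

text \<open>The gain operator is defined by real test functions. The functions \<open>cos (x \<bullet> k - \<theta>)\<close>, with a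
  phase \<open>\<theta>\<close> to choose, are enough to recover the complex number \<open>fourier f k\<close>.\<close>

lemma integral_cos_eq_Re_fourier:
  "(\<integral>x. cos (x \<bullet> k - \<theta>) \<partial>f) = Re (cis \<theta> * fourier f k)"
proof -
  have "(\<integral>x. cos (x \<bullet> k - \<theta>) \<partial>f) = (\<integral>x. Re (cis \<theta> * cis (- (x \<bullet> k))) \<partial>f)"
    by (intro Bochner_Integration.integral_cong) (auto simp: cis_mult cos_diff sin_diff)
  also have "\<dots> = Re (\<integral>x. cis \<theta> * cis (- (x \<bullet> k)) \<partial>f)"
    by (intro integral_Re integrable_mult_cis_inner)
  also have "\<dots> = Re (cis \<theta> * fourier f k)"
    by (simp add: fourier_eq_cis)
  finally show ?thesis .
qed

lemma integral_integral_cos_eq_Re_fourier: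
  "(\<integral>v. \<integral>w. cos (v \<bullet> p + w \<bullet> q - \<theta>) \<partial>f \<partial>f) = Re (cis \<theta> * (fourier f p * fourier f q))"
proof -
  have "(\<integral>v. \<integral>w. cos (v \<bullet> p + w \<bullet> q - \<theta>) \<partial>f \<partial>f) = (\<integral>v. Re (cis \<theta> * fourier f q * cis (- (v \<bullet> p))) \<partial>f)"
  proof (intro Bochner_Integration.integral_cong refl)
    fix v
    have "(\<integral>w. cos (v \<bullet> p + w \<bullet> q - \<theta>) \<partial>f) = (\<integral>w. cos (w \<bullet> q - (\<theta> - v \<bullet> p)) \<partial>f)"
      by (simp add: algebra_simps)
    also have "\<dots> = Re (cis (\<theta> - v \<bullet> p) * fourier f q)" by (rule integral_cos_eq_Re_fourier)
    also have "cis (\<theta> - v \<bullet> p) * fourier f q = cis \<theta> * fourier f q * cis (- (v \<bullet> p))"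
      by (simp add: cis_mult[symmetric] diff_conv_add_uminus del: cis_mult add_uminus_conv_diff)
    finally show "(\<integral>w. cos (v \<bullet> p + w \<bullet> q - \<theta>) \<partial>f) = Re (cis \<theta> * fourier f q * cis (- (v \<bullet> p)))" .
  qed
  also have "\<dots> = Re (\<integral>v. cis \<theta> * fourier f q * cis (- (v \<bullet> p)) \<partial>f)"
    by (intro integral_Re integrable_mult_cis_inner)
  also have "\<dots> = Re (cis \<theta> * (fourier f p * fourier f q))"
    by (simp add: fourier_eq_cis[of f p] mult_ac)
  finally show ?thesis .
qed

end

text \<open>In \<open>v' \<bullet> k\<close> the direction \<open>\<sigma>\<close> occurs as \<open>|v - w| (\<sigma> \<bullet> k)\<close>. After averaging over the sphere this
  may be replaced by \<open>|k| (\<sigma> \<bullet> (v - w))\<close>, which is linear in \<open>v\<close> and \<open>w\<close>: the two velocities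
  decouple, each with its own frequency.\<close>

lemma sphere_integral_cos_post_velocity:
  "(\<integral>\<sigma>. cos (post_velocity et v w \<sigma> \<bullet> k - \<theta>) \<partial>sphere_measure)
    = (\<integral>\<sigma>. cos (v \<bullet> k_plus et k \<sigma> + w \<bullet> k_minus et k \<sigma> - \<theta>) \<partial>sphere_measure)"
proof -
  define F where "F r = cos (((3 - et) / 4) * (v \<bullet> k) + ((1 + et) / 4) * (w \<bullet> k) + (1 + et) / 4 * r - \<theta>)"
    for r
  have [measurable]: "F \<in> borel_measurable borel" unfolding F_def by measurable
  have "cos (post_velocity et v w \<sigma> \<bullet> k - \<theta>) = F (norm (v - w) * (\<sigma> \<bullet> k))" for \<sigma>
    unfolding F_def post_velocity_def
    by (rule arg_cong[where f = cos]) (simp add: algebra_simps inner_simps add_divide_distrib diff_divide_distrib)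
  moreover have "cos (v \<bullet> k_plus et k \<sigma> + w \<bullet> k_minus et k \<sigma> - \<theta>) = F (norm k * (\<sigma> \<bullet> (v - w)))" for \<sigma>
    unfolding F_def k_plus_def k_minus_def
    by (rule arg_cong[where f = cos])
       (simp add: algebra_simps inner_simps inner_commute add_divide_distrib diff_divide_distrib)
  ultimately show ?thesis using integral_sphere_swap[of F "v - w" k] by simp
qed

lemma gain_is_gain:
  assumes "real_distribution \<mu>" "prob_space f" "sets f = sets borel"
  shows "is_gain e \<mu> f (gain e \<mu> f)"
  unfolding gain_def by (rule theI'[OF is_gain_ex1[OF assms]])

lemma integrable_fourier_product:
  assumes f: "prob_space f" "sets f = sets borel"
    and M: "finite_measure M" and [measurable]: "h \<in> borel_measurable M" "h' \<in> borel_measurable M"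
  shows "integrable M (\<lambda>x. fourier f (h x) * fourier f (h' x))"
proof -
  interpret finite_measure M by fact
  note [measurable] = measurable_fourier[OF f]
  show ?thesis
    by (rule integrable_const_bound[where B = 1])
       (auto simp: norm_mult intro!: mult_le_one norm_fourier_le_1[OF f])
qed

lemma integrable_angular_fourier_product:
  assumes mu: "real_distribution \<mu>" and f: "prob_space f" "sets f = sets borel"
  shows "integrable sphere_measure (\<lambda>\<sigma>. fourier f (k_plus et k \<sigma>) * fourier f (k_minus et k \<sigma>))"
    and "integrable \<mu> (\<lambda>\<eta>. \<integral>\<sigma>. fourier f (k_plus (e + \<eta>) k \<sigma>) * fourier f (k_minus (e + \<eta>) k \<sigma>) \<partial>sphere_measure)"
proof -
  interpret mu: real_distribution \<mu> by fact
  interpret S: finite_measure "sphere_measure :: (real^3) measure" by (rule finite_measure_sphere_measure)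
  have borel_measurable_ident_mu: "(\<lambda>\<eta>. \<eta>) \<in> borel_measurable \<mu>" by simp
  note [measurable] = measurable_sphere_measure_ident
  let ?H = "\<lambda>et \<sigma>. fourier f (k_plus et k \<sigma>) * fourier f (k_minus et k \<sigma>)"
  let ?G = "\<lambda>\<eta>. ?H (e + \<eta>)"
  show intG: "integrable sphere_measure (?H et)" for et
    by (intro integrable_fourier_product f finite_measure_sphere_measure) measurable
  have normG: "cmod (\<integral>\<sigma>. ?G \<eta> \<sigma> \<partial>sphere_measure) \<le> 4 * pi" for \<eta>
  proof -
    have "cmod (\<integral>\<sigma>. ?G \<eta> \<sigma> \<partial>sphere_measure) \<le> (\<integral>\<sigma>. cmod (?G \<eta> \<sigma>) \<partial>sphere_measure)"
      by (rule integral_norm_bound)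
    also have "\<dots> \<le> (\<integral>\<sigma>. 1 \<partial>(sphere_measure :: (real^3) measure))"
      using intG by (intro integral_mono integrable_norm) (auto simp: norm_mult intro!: mult_le_one norm_fourier_le_1[OF f])
    finally show ?thesis by (simp add: measure_def space_sphere_measure emeasure_sphere_measure)
  qed
  show "integrable \<mu> (\<lambda>\<eta>. \<integral>\<sigma>. ?G \<eta> \<sigma> \<partial>sphere_measure)"
  proof (rule mu.integrable_const_bound[where B = "4 * pi"])
    have "(\<lambda>x. ?G (fst x) (snd x)) \<in> borel_measurable (\<mu> \<Otimes>\<^sub>M sphere_measure)"
      by (intro borel_measurable_times measurable_compose[OF _ measurable_fourier[OF f]] measurable_k_plus
          measurable_k_minus borel_measurable_add measurable_compose[OF measurable_fst borel_measurable_ident_mu]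
          measurable_compose[OF measurable_snd measurable_sphere_measure_ident]) simp_all
    then show "(\<lambda>\<eta>. \<integral>\<sigma>. ?G \<eta> \<sigma> \<partial>sphere_measure) \<in> borel_measurable \<mu>"
      by (intro S.borel_measurable_lebesgue_integral) (simp add: case_prod_beta)
  qed (auto simp: normG)
qed

text \<open>Bobylev's formula. After the exchange of \<open>k\<close> and \<open>v - w\<close> under the spherical average, the
  exponential of the post-collision velocity is a product of a function of \<open>v\<close> and a function of \<open>w\<close>, so that
  integrating first over the two velocities produces a product of two Fourier transforms.\<close>

theorem fourier_gain:
  assumes mu: "real_distribution \<mu>" and f: "prob_space f" "sets f = sets borel"
  shows "fourier (gain e \<mu> f) k = complex_of_real (1 / (4 * pi)) *
    (\<integral>\<eta>. \<integral>\<sigma>. fourier f (k_plus (e + \<eta>) k \<sigma>) * fourier f (k_minus (e + \<eta>) k \<sigma>) \<partial>sphere_measure \<partial>\<mu>)"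
    (is "?Q = _ * ?I")
proof -
  interpret f: prob_space f by fact
  interpret mu: real_distribution \<mu> by fact
  interpret S: finite_measure "sphere_measure :: (real^3) measure" by (rule finite_measure_sphere_measure)
  interpret fS: pair_sigma_finite f "sphere_measure :: (real^3) measure" ..
  interpret Sf: pair_sigma_finite "sphere_measure :: (real^3) measure" f ..
  interpret fSfin: finite_measure "f \<Otimes>\<^sub>M (sphere_measure :: (real^3) measure)"
    by (rule finite_measure_pair_measure) (unfold_locales)
  interpret Sffin: finite_measure "(sphere_measure :: (real^3) measure) \<Otimes>\<^sub>M f"
    by (rule finite_measure_pair_measure) (unfold_locales)
  have borel_measurable_ident_f: "(\<lambda>v. v) \<in> borel_measurable f" by (rule measurable_ident_sets[OF f(2)])
  note [measurable] = measurable_sphere_measure_ident and [measurable_cong] = f(2)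
  have gain: "prob_space (gain e \<mu> f)" "sets (gain e \<mu> f) = sets borel"
    using gain_is_gain[OF mu f, of e] by (auto simp: is_gain_def)
  let ?G = "\<lambda>\<eta> \<sigma>. fourier f (k_plus (e + \<eta>) k \<sigma>) * fourier f (k_minus (e + \<eta>) k \<sigma>)"
  note intG = integrable_angular_fourier_product(1)[OF mu f]
  note intmu = integrable_angular_fourier_product(2)[OF mu f]
  \<comment> \<open>both sides agree after multiplication by any \<open>cis \<theta>\<close> and taking real parts; \<open>\<theta> = 0\<close> and \<open>\<theta> = \<pi> / 2\<close> suffice\<close>
  have key: "Re (cis \<theta> * ?Q) = Re (cis \<theta> * (complex_of_real (1 / (4 * pi)) * ?I))" for \<theta>
  proof -
    let ?c = "\<lambda>\<eta> v w \<sigma>. cos (v \<bullet> k_plus (e + \<eta>) k \<sigma> + w \<bullet> k_minus (e + \<eta>) k \<sigma> - \<theta>)"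
    have c_measurable: "(\<lambda>(v, w, \<sigma>). ?c \<eta> v w \<sigma>) \<in> borel_measurable (borel \<Otimes>\<^sub>M borel \<Otimes>\<^sub>M borel)" for \<eta>
      by measurable
    \<comment> \<open>the fixed-coefficient case: Fubini, then both velocities are integrated out\<close>
    have swap: "(\<integral>v. \<integral>w. \<integral>\<sigma>. ?c \<eta> v w \<sigma> \<partial>sphere_measure \<partial>f \<partial>f) = Re (cis \<theta> * (\<integral>\<sigma>. ?G \<eta> \<sigma> \<partial>sphere_measure))" for \<eta>
    proof -
      have "(\<integral>v. \<integral>w. \<integral>\<sigma>. ?c \<eta> v w \<sigma> \<partial>sphere_measure \<partial>f \<partial>f) = (\<integral>v. \<integral>\<sigma>. \<integral>w. ?c \<eta> v w \<sigma> \<partial>f \<partial>sphere_measure \<partial>f)"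
      proof (rule Bochner_Integration.integral_cong[OF refl], rule fS.Fubini_integral[symmetric],
          rule fSfin.integrable_const_bound[where B = 1])
        fix v :: "real^3"
        have "(\<lambda>x. (v, fst x, snd x)) \<in> f \<Otimes>\<^sub>M (sphere_measure :: (real^3) measure) \<rightarrow>\<^sub>M borel \<Otimes>\<^sub>M borel \<Otimes>\<^sub>M borel"
          using measurable_compose[OF measurable_fst borel_measurable_ident_f]
            measurable_compose[OF measurable_snd measurable_sphere_measure_ident]
          by (intro measurable_Pair measurable_const) simp_all
        from measurable_compose[OF this c_measurable]
        show "(\<lambda>(w, \<sigma>). ?c \<eta> v w \<sigma>) \<in> borel_measurable (f \<Otimes>\<^sub>M sphere_measure)"
          by (simp add: case_prod_beta)
      qed auto
      also have "\<dots> = (\<integral>\<sigma>. \<integral>v. \<integral>w. ?c \<eta> v w \<sigma> \<partial>f \<partial>f \<partial>sphere_measure)"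
      proof (rule Sf.Fubini_integral, rule Sffin.integrable_const_bound[where B = 1])
        have "\<bar>\<integral>w. ?c \<eta> v w \<sigma> \<partial>f\<bar> \<le> 1" for v \<sigma>
        proof -
          have [measurable]: "(\<lambda>w. ?c \<eta> v w \<sigma>) \<in> borel_measurable f"
            unfolding measurable_cong_sets[OF f(2) refl] by measurable
          have "\<bar>\<integral>w. ?c \<eta> v w \<sigma> \<partial>f\<bar> \<le> (\<integral>w. \<bar>?c \<eta> v w \<sigma>\<bar> \<partial>f)" by (rule integral_abs_bound)
          also have "\<dots> \<le> (\<integral>w. 1 \<partial>f)"
            by (intro integral_mono f.integrable_const_bound[where B = 1]) auto
          finally show ?thesis by (simp add: f.prob_space)
        qed
        then show "AE x in sphere_measure \<Otimes>\<^sub>M f. norm (case x of (\<sigma>, v) \<Rightarrow> \<integral>w. ?c \<eta> v w \<sigma> \<partial>f) \<le> 1"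
          by auto
        show "(\<lambda>(\<sigma>, v). \<integral>w. ?c \<eta> v w \<sigma> \<partial>f) \<in> borel_measurable (sphere_measure \<Otimes>\<^sub>M f)"
        proof -
          have "(\<lambda>x. (snd (fst x), snd x, fst (fst x)))
              \<in> ((sphere_measure :: (real^3) measure) \<Otimes>\<^sub>M f) \<Otimes>\<^sub>M f \<rightarrow>\<^sub>M borel \<Otimes>\<^sub>M borel \<Otimes>\<^sub>M borel"
            using measurable_compose[OF measurable_snd borel_measurable_ident_f]
              measurable_compose[OF measurable_compose[OF measurable_fst measurable_snd] borel_measurable_ident_f]
              measurable_compose[OF measurable_compose[OF measurable_fst measurable_fst]
                measurable_sphere_measure_ident]
            by (intro measurable_Pair) simp_all
          from measurable_compose[OF this c_measurable]
          have "(\<lambda>(x, w). ?c \<eta> (snd x) w (fst x)) \<in> borel_measurable ((sphere_measure \<Otimes>\<^sub>M f) \<Otimes>\<^sub>M f)"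
            by (simp add: case_prod_beta)
          then have "(\<lambda>x. \<integral>w. ?c \<eta> (snd x) w (fst x) \<partial>f) \<in> borel_measurable (sphere_measure \<Otimes>\<^sub>M f)"
            by (rule f.borel_measurable_lebesgue_integral)
          then show ?thesis by (simp add: case_prod_beta)
        qed
      qed
      also have "\<dots> = (\<integral>\<sigma>. Re (cis \<theta> * ?G \<eta> \<sigma>) \<partial>sphere_measure)"
        by (simp only: integral_integral_cos_eq_Re_fourier[OF f])
      also have "\<dots> = Re (\<integral>\<sigma>. cis \<theta> * ?G \<eta> \<sigma> \<partial>sphere_measure)"
        by (intro integral_Re integrable_mult_right intG)
      finally show ?thesis by simp
    qed
    have "continuous_on UNIV (\<lambda>x::real^3. cos (x \<bullet> k - \<theta>)) \<and> bounded (range (\<lambda>x::real^3. cos (x \<bullet> k - \<theta>)))"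
      by (intro conjI continuous_intros boundedI[where B = 1]) auto
    then have "(\<integral>x. cos (x \<bullet> k - \<theta>) \<partial>gain e \<mu> f) = 1 / (4 * pi) * (\<integral>\<eta>. (\<integral>v. (\<integral>w. (\<integral>\<sigma>.
        cos (post_velocity (e + \<eta>) v w \<sigma> \<bullet> k - \<theta>) \<partial>sphere_measure) \<partial>f) \<partial>f) \<partial>\<mu>)"
      using gain_is_gain[OF mu f, of e, unfolded is_gain_def] by blast
    also have "\<dots> = 1 / (4 * pi) * (\<integral>\<eta>. Re (cis \<theta> * (\<integral>\<sigma>. ?G \<eta> \<sigma> \<partial>sphere_measure)) \<partial>\<mu>)"
      by (simp only: sphere_integral_cos_post_velocity swap)
    also have "(\<integral>\<eta>. Re (cis \<theta> * (\<integral>\<sigma>. ?G \<eta> \<sigma> \<partial>sphere_measure)) \<partial>\<mu>)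
        = Re (\<integral>\<eta>. cis \<theta> * (\<integral>\<sigma>. ?G \<eta> \<sigma> \<partial>sphere_measure) \<partial>\<mu>)"
      by (intro integral_Re integrable_mult_right intmu)
    also have "(\<integral>\<eta>. cis \<theta> * (\<integral>\<sigma>. ?G \<eta> \<sigma> \<partial>sphere_measure) \<partial>\<mu>) = cis \<theta> * ?I" by simp
    also have "1 / (4 * pi) * Re (cis \<theta> * ?I) = Re (cis \<theta> * (complex_of_real (1 / (4 * pi)) * ?I))"
      by (subst mult.left_commute) (simp only: Re_complex_of_real Im_complex_of_real times_complex.sel mult_zero_left diff_zero)
    also have "(\<integral>x. cos (x \<bullet> k - \<theta>) \<partial>gain e \<mu> f) = Re (cis \<theta> * ?Q)"
      by (rule integral_cos_eq_Re_fourier[OF gain])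
    finally show ?thesis .
  qed
  show ?thesis
    using key[of 0] key[of "pi / 2"] by (simp add: complex_eq_iff)
qed

section \<open>Angular averages of the two frequencies\<close>

text \<open>The end points of the interval, where the base may vanish, are excluded from differentiation.\<close>

lemma powr_affine_has_integral:
  fixes A B p :: real
  assumes "p \<ge> 0" "B \<noteq> 0" "\<bar>B\<bar> \<le> A"
  shows "((\<lambda>t. (A + B * t) powr p) has_integral
    ((A + B) powr (p + 1) - (A - B) powr (p + 1)) / ((p + 1) * B)) {-1..1}"
proof -
  have pos: "A + B * t > 0" if "t \<in> {-1<..<1}" for t
  proof -
    have "\<bar>B * t\<bar> < \<bar>B\<bar>" using that assms by (simp add: abs_mult mult_less_cancel_left2 abs_less_iff)
    then show ?thesis using assms by linarith
  qed
  have nonneg: "A + B * t \<ge> 0" if "t \<in> {-1..1}" for t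
  proof -
    have "\<bar>B * t\<bar> \<le> \<bar>B\<bar>" using that assms by (simp add: abs_mult mult_left_le abs_le_iff)
    then show ?thesis using assms by linarith
  qed
  have "((\<lambda>t. (A + B * t) powr p) has_integral
      (A + B * 1) powr (p + 1) / ((p + 1) * B) - (A + B * (-1)) powr (p + 1) / ((p + 1) * B)) {-1..1}"
  proof (rule fundamental_theorem_of_calculus_interior)
    show "continuous_on {-1..1} (\<lambda>t. (A + B * t) powr (p + 1) / ((p + 1) * B))"
      using assms by (intro continuous_intros continuous_on_powr') (auto simp: nonneg)
    fix t :: real assume "t \<in> {-1<..<1}"
    then have "((\<lambda>t. (A + B * t) powr (p + 1)) has_real_derivative
        (p + 1) * (A + B * t) powr (p + 1 - 1) * B) (at t)"
      using pos[of t] DERIV_fun_powr[of "\<lambda>t. A + B * t" B t "p + 1"]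
      by (auto intro!: derivative_eq_intros)
    from DERIV_cdivide[OF this, of "(p + 1) * B"]
    show "((\<lambda>t. (A + B * t) powr (p + 1) / ((p + 1) * B)) has_vector_derivative (A + B * t) powr p) (at t)"
      using assms by (simp add: has_real_derivative_iff_has_vector_derivative)
  qed simp
  then show ?thesis by (simp add: diff_divide_distrib)
qed

lemma nn_integral_sphere_affine_powr:
  fixes n :: "real^3"
  assumes "norm n = 1" "p \<ge> 0" "B \<noteq> 0" "\<bar>B\<bar> \<le> A"
  shows "(\<integral>\<^sup>+\<sigma>. ennreal ((A + B * (\<sigma> \<bullet> n)) powr p) \<partial>sphere_measure)
    = ennreal (2 * pi * (((A + B) powr (p + 1) - (A - B) powr (p + 1)) / ((p + 1) * B)))"
proof -
  have "((\<lambda>t. (A + B * t) powr p) has_integral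
      ((A + B) powr (p + 1) - (A - B) powr (p + 1)) / ((p + 1) * B)) {-1<..<1}"
    using powr_affine_has_integral[OF assms(2-4)] by (simp add: has_integral_Icc_iff_Ioo)
  from nn_integral_has_integral_lebesgue[OF _ this]
  have "(\<integral>\<^sup>+t. ennreal ((A + B * t) powr p) * indicator {-1<..<1} t \<partial>lborel)
      = ennreal (((A + B) powr (p + 1) - (A - B) powr (p + 1)) / ((p + 1) * B))"
    by (simp add: ennreal_mult' ennreal_indicator mult.commute)
  moreover have "(\<integral>\<^sup>+\<sigma>. ennreal ((A + B * (\<sigma> \<bullet> n)) powr p) \<partial>sphere_measure)
      = ennreal (2 * pi) * (\<integral>\<^sup>+t. ennreal ((A + B * t) powr p) * indicator {-1<..<1} t \<partial>lborel)"
    using assms(1) by (intro nn_integral_sphere_height[of "\<lambda>t. ennreal ((A + B * t) powr p)"]) auto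
  moreover have "ennreal (2 * pi * x) = ennreal (2 * pi) * ennreal x" for x
    by (rule ennreal_mult') simp
  ultimately show ?thesis by (simp only:)
qed

lemma norm_powr_eq: "norm (x :: 'a::real_inner) powr s = (x \<bullet> x) powr (s / 2)"
proof -
  have "norm x powr s = (norm x powr 2) powr (s / 2)" by (simp only: powr_powr) simp
  also have "norm x powr 2 = x \<bullet> x" by (simp add: dot_square_norm)
  finally show ?thesis .
qed

text \<open>With \<open>b = (1 + et) / 4\<close> and \<open>t\<close> the cosine of the angle between \<open>k\<close> and \<open>\<sigma>\<close>, one has
  \<open>|k_minus|\<^sup>2 = |k|\<^sup>2 (2 b\<^sup>2 - 2 b\<^sup>2 t)\<close>, an affine function of a uniformly distributed variable.\<close>

lemma nn_integral_norm_k_minus: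
  fixes k :: "real^3"
  assumes "et \<ge> 0" "s \<ge> 0"
  shows "(\<integral>\<^sup>+\<sigma>. ennreal (norm (k_minus et k \<sigma>) powr s) \<partial>sphere_measure)
    = ennreal (norm k powr s * (4 * pi * (2 / (s + 2)) * ((1 + et) / 2) powr s))"
proof (cases "k = 0")
  case False
  define n where "n = sgn k"
  have n: "norm n = 1" "k = norm k *\<^sub>R n" using False by (simp_all add: n_def norm_sgn sgn_div_norm)
  define b where "b = (1 + et) / 4"
  have b: "b > 0" using assms by (simp add: b_def)
  have eq: "norm (k_minus et k \<sigma>) powr s = norm k powr s * (2 * b\<^sup>2 + (- 2 * b\<^sup>2) * (\<sigma> \<bullet> n)) powr (s / 2)"
    if "\<sigma> \<in> sphere 0 1" for \<sigma>
  proof -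
    have sn: "\<sigma> \<bullet> \<sigma> = 1" "n \<bullet> n = 1" using that n(1) by (simp_all add: dot_square_norm)
    have "k_minus et k \<sigma> = norm k *\<^sub>R (b *\<^sub>R (n - \<sigma>))"
      unfolding k_minus_def b_def[symmetric] by (subst (1) n(2)) (simp add: algebra_simps)
    then have "norm (k_minus et k \<sigma>) = norm k * norm (b *\<^sub>R (n - \<sigma>))"
      by (simp only: norm_scaleR abs_norm_cancel)
    moreover have "norm (b *\<^sub>R (n - \<sigma>)) powr s = (2 * b\<^sup>2 + (- 2 * b\<^sup>2) * (\<sigma> \<bullet> n)) powr (s / 2)"
      unfolding norm_powr_eq
      by (rule arg_cong[where f = "\<lambda>x. x powr (s / 2)"])
         (simp add: inner_diff_left inner_diff_right sn inner_commute algebra_simps power2_eq_square)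
    ultimately show ?thesis by (simp add: powr_mult)
  qed
  have "(\<integral>\<^sup>+\<sigma>. ennreal (norm (k_minus et k \<sigma>) powr s) \<partial>sphere_measure)
    = (\<integral>\<^sup>+\<sigma>. ennreal (norm k powr s) * ennreal ((2 * b\<^sup>2 + (- 2 * b\<^sup>2) * (\<sigma> \<bullet> n)) powr (s / 2)) \<partial>sphere_measure)"
    by (intro nn_integral_cong) (simp add: space_sphere_measure eq ennreal_mult')
  also have "\<dots> = ennreal (norm k powr s) * (\<integral>\<^sup>+\<sigma>. ennreal ((2 * b\<^sup>2 + (- 2 * b\<^sup>2) * (\<sigma> \<bullet> n)) powr (s / 2)) \<partial>sphere_measure)"
    by (intro nn_integral_cmult measurable_compose[OF measurable_sphere_measure_ident]) measurable
  also have "(\<integral>\<^sup>+\<sigma>. ennreal ((2 * b\<^sup>2 + (- 2 * b\<^sup>2) * (\<sigma> \<bullet> n)) powr (s / 2)) \<partial>sphere_measure)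
      = ennreal (2 * pi * (((2 * b\<^sup>2 + - 2 * b\<^sup>2) powr (s / 2 + 1) - (2 * b\<^sup>2 - (- 2 * b\<^sup>2)) powr (s / 2 + 1))
          / ((s / 2 + 1) * (- 2 * b\<^sup>2))))"
    using assms b n by (intro nn_integral_sphere_affine_powr) auto
  also have "2 * pi * (((2 * b\<^sup>2 + - 2 * b\<^sup>2) powr (s / 2 + 1) - (2 * b\<^sup>2 - (- 2 * b\<^sup>2)) powr (s / 2 + 1))
          / ((s / 2 + 1) * (- 2 * b\<^sup>2))) = 4 * pi * (2 / (s + 2)) * ((1 + et) / 2) powr s"
  proof -
    have "(4 * b\<^sup>2) powr (s / 2 + 1) = (4 * b\<^sup>2) powr (s / 2) * (4 * b\<^sup>2)"
      using b by (simp add: powr_add)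
    also have "(4 * b\<^sup>2) powr (s / 2) = (2 * b) powr s"
    proof -
      have "4 * b\<^sup>2 = (2 * b) powr 2" using b by (simp add: power2_eq_square)
      then show ?thesis by (simp add: powr_powr)
    qed
    also have "2 * b = (1 + et) / 2" by (simp add: b_def)
    finally have *: "(4 * b\<^sup>2) powr (s / 2 + 1) = ((1 + et) / 2) powr s * (4 * b\<^sup>2)" .
    show ?thesis using b assms by (simp add: *)
  qed
  finally show ?thesis by (simp only: ennreal_mult'[OF powr_ge_zero])
qed (simp add: k_minus_def)

text \<open>With \<open>a = (3 - et) / 4\<close> and \<open>b = (1 + et) / 4\<close>, one has \<open>|k_plus|\<^sup>2 = |k|\<^sup>2 (a\<^sup>2 + b\<^sup>2 + 2 a b t)\<close>, where
  \<open>t\<close> is uniformly distributed. The end point values of the base are \<open>(a + b)\<^sup>2 = 1\<close> and \<open>(a - b)\<^sup>2\<close>, and the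
  factor \<open>4 a b = (a + b)\<^sup>2 - (a - b)\<^sup>2\<close> in the denominator turns the integral into the contraction
  quotient at \<open>|a - b| = |1 - et| / 2\<close>.\<close>

lemma nn_integral_norm_k_plus:
  fixes k :: "real^3"
  assumes "et \<ge> 0" "\<alpha> \<ge> 0"
  shows "(\<integral>\<^sup>+\<sigma>. ennreal (norm (k_plus et k \<sigma>) powr (2 + \<alpha>)) \<partial>sphere_measure)
    = ennreal (norm k powr (2 + \<alpha>) * (4 * pi * (2 / (4 + \<alpha>)) * contraction_quotient \<alpha> \<bar>(1 - et) / 2\<bar>))"
proof (cases "k = 0")
  case False
  define n where "n = sgn k"
  have n: "norm n = 1" "k = norm k *\<^sub>R n" using False by (simp_all add: n_def norm_sgn sgn_div_norm)
  define s where "s = 2 + \<alpha>"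
  define a where "a = (3 - et) / 4"
  define b where "b = (1 + et) / 4"
  have b: "b > 0" using assms by (simp add: b_def)
  have ab: "a + b = 1" "a - b = (1 - et) / 2" by (simp_all add: a_def b_def field_simps)
  have kp: "k_plus et k \<sigma> = norm k *\<^sub>R (a *\<^sub>R n + b *\<^sub>R \<sigma>)" for \<sigma>
    unfolding k_plus_def b_def[symmetric] a_def[symmetric] by (subst (1) n(2)) (simp add: algebra_simps)
  have eq: "norm (k_plus et k \<sigma>) powr s = norm k powr s * ((a\<^sup>2 + b\<^sup>2) + (2 * a * b) * (\<sigma> \<bullet> n)) powr (s / 2)"
    if "\<sigma> \<in> sphere 0 1" for \<sigma>
  proof -
    have sn: "\<sigma> \<bullet> \<sigma> = 1" "n \<bullet> n = 1" using that n(1) by (simp_all add: dot_square_norm)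
    have "norm (a *\<^sub>R n + b *\<^sub>R \<sigma>) powr s = ((a\<^sup>2 + b\<^sup>2) + (2 * a * b) * (\<sigma> \<bullet> n)) powr (s / 2)"
      unfolding norm_powr_eq
      by (rule arg_cong[where f = "\<lambda>x. x powr (s / 2)"])
         (simp add: inner_add_left inner_add_right sn inner_commute algebra_simps power2_eq_square)
    then show ?thesis by (simp add: kp powr_mult)
  qed
  have m: "(\<lambda>\<sigma>. ennreal (((a\<^sup>2 + b\<^sup>2) + (2 * a * b) * (\<sigma> \<bullet> n)) powr (s / 2))) \<in> borel_measurable sphere_measure"
    by (intro measurable_compose[OF measurable_sphere_measure_ident]) measurable
  have "(\<integral>\<^sup>+\<sigma>. ennreal (norm (k_plus et k \<sigma>) powr s) \<partial>sphere_measure)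
    = (\<integral>\<^sup>+\<sigma>. ennreal (norm k powr s) * ennreal (((a\<^sup>2 + b\<^sup>2) + (2 * a * b) * (\<sigma> \<bullet> n)) powr (s / 2)) \<partial>sphere_measure)"
    by (intro nn_integral_cong) (simp add: space_sphere_measure eq ennreal_mult')
  also have "\<dots> = ennreal (norm k powr s) * (\<integral>\<^sup>+\<sigma>. ennreal (((a\<^sup>2 + b\<^sup>2) + (2 * a * b) * (\<sigma> \<bullet> n)) powr (s / 2)) \<partial>sphere_measure)"
    by (rule nn_integral_cmult[OF m])
  also have "(\<integral>\<^sup>+\<sigma>. ennreal (((a\<^sup>2 + b\<^sup>2) + (2 * a * b) * (\<sigma> \<bullet> n)) powr (s / 2)) \<partial>sphere_measure)
     = ennreal (4 * pi * (2 / (4 + \<alpha>)) * contraction_quotient \<alpha> \<bar>(1 - et) / 2\<bar>)"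
  proof (cases "a = 0")
    case True
    \<comment> \<open>here \<open>et = 3\<close> and \<open>k_plus\<close> has the length of \<open>k\<close>; this is the point where the quotient is defined by continuity\<close>
    then have "b = 1" using ab by simp
    moreover have "\<bar>(1 - et) / 2\<bar> = 1" using True ab by auto
    ultimately show ?thesis using True assms
      by (simp add: space_sphere_measure emeasure_sphere_measure contraction_quotient_def)
  next
    case False
    have "\<bar>2 * a * b\<bar> \<le> a\<^sup>2 + b\<^sup>2"
      using zero_le_power2[of "a - b"] zero_le_power2[of "a + b"] by (simp add: power2_diff power2_sum abs_le_iff)
    then have "(\<integral>\<^sup>+\<sigma>. ennreal (((a\<^sup>2 + b\<^sup>2) + (2 * a * b) * (\<sigma> \<bullet> n)) powr (s / 2)) \<partial>sphere_measure)
      = ennreal (2 * pi * (((a\<^sup>2 + b\<^sup>2 + 2 * a * b) powr (s / 2 + 1) - (a\<^sup>2 + b\<^sup>2 - 2 * a * b) powr (s / 2 + 1))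
          / ((s / 2 + 1) * (2 * a * b))))"
      using False b n assms by (intro nn_integral_sphere_affine_powr) (auto simp: s_def)
    also have "a\<^sup>2 + b\<^sup>2 + 2 * a * b = 1"
      using ab(1) power2_sum[of a b] by simp
    also have "(a\<^sup>2 + b\<^sup>2 - 2 * a * b) powr (s / 2 + 1) = \<bar>a - b\<bar> powr (4 + \<alpha>)"
    proof -
      have "a\<^sup>2 + b\<^sup>2 - 2 * a * b = \<bar>a - b\<bar> powr 2" by (simp add: power2_diff)
      then have "(a\<^sup>2 + b\<^sup>2 - 2 * a * b) powr (s / 2 + 1) = \<bar>a - b\<bar> powr (2 * (s / 2 + 1))"
        by (simp only: powr_powr)
      also have "2 * (s / 2 + 1) = 4 + \<alpha>" by (simp add: s_def)
      finally show ?thesis .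
    qed
    also have "2 * pi * ((1 powr (s / 2 + 1) - \<bar>a - b\<bar> powr (4 + \<alpha>)) / ((s / 2 + 1) * (2 * a * b)))
      = 4 * pi * (2 / (4 + \<alpha>)) * contraction_quotient \<alpha> \<bar>a - b\<bar>"
    proof -
      have q: "1 - \<bar>a - b\<bar>\<^sup>2 = 4 * a * b"
        using ab(1) power2_sum[of a b] by (simp add: power2_diff)
      have "\<bar>a - b\<bar> \<noteq> 1"
      proof
        assume h: "\<bar>a - b\<bar> = 1"
        from q have "1 - 1\<^sup>2 = 4 * a * b" unfolding h .
        then show False using False b by simp
      qed
      then have c1: "contraction_quotient \<alpha> \<bar>a - b\<bar> = (1 - \<bar>a - b\<bar> powr (4 + \<alpha>)) / (4 * a * b)"
        unfolding contraction_quotient_def q by simp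
      have c2: "s / 2 + 1 = (4 + \<alpha>) / 2" by (simp add: s_def field_simps)
      have "2 * pi * ((1 - P) / ((c / 2) * (2 * a * b))) = 4 * pi * (2 / c) * ((1 - P) / (4 * a * b))"
        if "c > 0" for P c :: real
        using that False b by (simp add: field_simps)
      from this[of "4 + \<alpha>"] show ?thesis unfolding c1 c2 powr_one_eq_one using assms by simp
    qed
    also have "a - b = (1 - et) / 2" by (rule ab)
    finally show ?thesis .
  qed
  finally show ?thesis by (simp only: s_def ennreal_mult'[OF powr_ge_zero])
qed (use assms in \<open>simp add: k_plus_def\<close>)

lemma contraction_quotient_nonneg:
  assumes "x \<ge> 0" "\<alpha> \<ge> 0"
  shows "contraction_quotient \<alpha> x \<ge> 0"
proof -
  consider "x = 1" | "x < 1" | "x > 1" by linarith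
  then show ?thesis
  proof cases
    case 2
    then have "x powr (4 + \<alpha>) \<le> 1" "x\<^sup>2 \<le> 1" using assms by (auto simp: powr_le1 abs_square_le_1)
    then show ?thesis using 2 by (simp add: contraction_quotient_def)
  next
    case 3
    then have "x powr (4 + \<alpha>) \<ge> 1" "x\<^sup>2 \<ge> 1" using assms by (auto simp: ge_one_powr_ge_zero)
    then show ?thesis using 3 by (simp add: contraction_quotient_def divide_nonpos_nonpos)
  qed (use assms in \<open>simp add: contraction_quotient_def\<close>)
qed

definition contraction_rate :: "real \<Rightarrow> real \<Rightarrow> real"
  where "contraction_rate \<alpha> et = ((1 + et) / 2) powr (2 + \<alpha>) + contraction_quotient \<alpha> \<bar>(1 - et) / 2\<bar>"

lemma measurable_contraction_rate [measurable]: "contraction_rate \<alpha> \<in> borel_measurable borel"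
  unfolding contraction_rate_def contraction_quotient_def by measurable

lemma contraction_rate_pos:
  assumes "et \<ge> 0" "\<alpha> \<ge> 0" shows "contraction_rate \<alpha> et > 0"
  using assms by (auto simp: contraction_rate_def intro!: add_pos_nonneg contraction_quotient_nonneg)

lemma contraction_const_eq:
  "contraction_const \<alpha> e \<mu> = ennreal (2 / (4 + \<alpha>)) * (\<integral>\<^sup>+\<eta>. ennreal (contraction_rate \<alpha> (e + \<eta>)) \<partial>\<mu>)"
  by (simp add: contraction_const_def contraction_rate_def)

lemma nn_integral_sphere_contraction_rate:
  fixes k :: "real^3"
  assumes "et \<ge> 0" "\<alpha> \<ge> 0"
  shows "(\<integral>\<^sup>+\<sigma>. ennreal (norm (k_plus et k \<sigma>) powr (2 + \<alpha>)) + ennreal (norm (k_minus et k \<sigma>) powr (2 + \<alpha>)) \<partial>sphere_measure)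
    = ennreal (norm k powr (2 + \<alpha>) * (4 * pi * (2 / (4 + \<alpha>)) * contraction_rate \<alpha> et))"
proof -
  have m: "(\<lambda>\<sigma>. ennreal (norm (k_plus et k \<sigma>) powr (2 + \<alpha>))) \<in> borel_measurable sphere_measure"
    "(\<lambda>\<sigma>. ennreal (norm (k_minus et k \<sigma>) powr (2 + \<alpha>))) \<in> borel_measurable sphere_measure"
    by (intro measurable_compose[OF measurable_sphere_measure_ident]; measurable)+
  show ?thesis
    unfolding nn_integral_add[OF m] nn_integral_norm_k_plus[OF assms]
      nn_integral_norm_k_minus[of et "2 + \<alpha>" k, OF assms(1) order_trans[OF zero_le_numeral add_increasing2[OF assms(2) order_refl]]]
    using assms contraction_quotient_nonneg[of "\<bar>(1 - et) / 2\<bar>" \<alpha>]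
    by (subst ennreal_plus[symmetric]) (auto simp: contraction_rate_def algebra_simps)
qed

text \<open>The rate is a multiple of the sum of the averages of \<open>|k_plus|\<close> and \<open>|k_minus|\<close> to the power
  \<open>2 + \<alpha>\<close> for a unit vector \<open>k\<close>, and both frequencies have length at most \<open>1 + et\<close>. This avoids estimating the
  quotient near its removable singularity.\<close>

lemma contraction_rate_le:
  assumes "et \<ge> 0" "\<alpha> \<ge> 0"
  shows "contraction_rate \<alpha> et \<le> (4 + \<alpha>) * (1 + et) powr (2 + \<alpha>)"
proof -
  let ?s = "2 + \<alpha>" and ?k = "axis 1 1 :: real^3"
  have k: "norm ?k = 1" by (simp add: norm_axis_1)
  have "norm (k_plus et ?k \<sigma>) \<le> 1 + et \<and> norm (k_minus et ?k \<sigma>) \<le> 1 + et" if "norm \<sigma> = 1" for \<sigma>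
  proof -
    have "norm (k_plus et ?k \<sigma>) \<le> \<bar>(3 - et) / 4\<bar> + \<bar>(1 + et) / 4\<bar>"
      unfolding k_plus_def using norm_triangle_ineq[of "((3 - et) / 4) *\<^sub>R ?k" "((1 + et) / 4 * norm ?k) *\<^sub>R \<sigma>"] that k
      by simp
    moreover have "norm (k_minus et ?k \<sigma>) \<le> \<bar>(1 + et) / 4\<bar> + \<bar>(1 + et) / 4\<bar>"
      unfolding k_minus_def using norm_triangle_ineq4[of "((1 + et) / 4) *\<^sub>R ?k" "((1 + et) / 4 * norm ?k) *\<^sub>R \<sigma>"] that k
      by simp
    moreover have "4 * \<bar>(3 - et) / 4\<bar> \<le> 3 + et" "4 * \<bar>(1 + et) / 4\<bar> = 1 + et"
      using assms by (simp_all add: abs_le_iff)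
    moreover have "x \<le> 1 + et \<and> y \<le> 1 + et"
      if "x \<le> u + v" "y \<le> v + v" "4 * u \<le> 3 + et" "4 * v = 1 + et" for x y u v :: real
      using that assms(1) by auto
    ultimately show ?thesis by blast
  qed
  then have "(\<integral>\<^sup>+\<sigma>. ennreal (norm (k_plus et ?k \<sigma>) powr ?s) + ennreal (norm (k_minus et ?k \<sigma>) powr ?s) \<partial>sphere_measure)
      \<le> (\<integral>\<^sup>+\<sigma>. ennreal ((1 + et) powr ?s) + ennreal ((1 + et) powr ?s) \<partial>(sphere_measure :: (real^3) measure))"
    using assms by (intro nn_integral_mono add_mono ennreal_leI powr_mono2) (auto simp: space_sphere_measure)
  also have "\<dots> = ennreal (2 * (1 + et) powr ?s * (4 * pi))"
    by (simp add: space_sphere_measure emeasure_sphere_measure ennreal_plus[symmetric] ennreal_mult[symmetric] del: ennreal_plus)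
  finally have "4 * pi * (2 / (4 + \<alpha>)) * contraction_rate \<alpha> et \<le> 2 * (1 + et) powr ?s * (4 * pi)"
    unfolding nn_integral_sphere_contraction_rate[OF assms] k using assms by simp
  then have "8 * pi * (contraction_rate \<alpha> et / (4 + \<alpha>)) \<le> 8 * pi * (1 + et) powr ?s"
    by (simp add: mult_ac)
  then have "contraction_rate \<alpha> et / (4 + \<alpha>) \<le> (1 + et) powr ?s"
    by (rule mult_left_le_imp_le) simp
  then show ?thesis using assms by (simp add: pos_divide_le_eq mult.commute)
qed

section \<open>The contraction estimate\<close>

text \<open>At \<open>k = 0\<close> the Fourier transforms of two probability measures agree, so the bound by the supremum
  extends from the frequencies in its definition to all of them.\<close>

lemma fourier_diff_le_fourier_dist:
  assumes "fourier f 0 = fourier g 0"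
  shows "ennreal (cmod (fourier f k - fourier g k)) \<le> fourier_dist s f g * ennreal (norm k powr s)"
proof (cases "k = 0")
  case False
  then have "ennreal (cmod (fourier f k - fourier g k))
      = ennreal (cmod (fourier f k - fourier g k) / norm k powr s) * ennreal (norm k powr s)"
    by (simp add: ennreal_mult[symmetric])
  also have "\<dots> \<le> fourier_dist s f g * ennreal (norm k powr s)"
    unfolding fourier_dist_def using False by (intro mult_right_mono SUP_upper) auto
  finally show ?thesis .
qed (use assms in simp)

text \<open>Fourier transforms of probability measures are bounded by \<open>1\<close>, so the difference of two products
  is bounded by the sum of the differences of the factors.\<close>

lemma fourier_product_diff_le:
  assumes f: "prob_space f" "sets f = sets borel" and g: "prob_space g" "sets g = sets borel"
  shows "ennreal (cmod (fourier f p * fourier f q - fourier g p * fourier g q))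
    \<le> fourier_dist s f g * (ennreal (norm p powr s) + ennreal (norm q powr s))"
proof -
  have "cmod (fourier f p * fourier f q - fourier g p * fourier g q)
      = cmod ((fourier f p - fourier g p) * fourier f q + fourier g p * (fourier f q - fourier g q))"
    by (simp add: algebra_simps)
  also have "\<dots> \<le> cmod (fourier f p - fourier g p) * cmod (fourier f q) + cmod (fourier g p) * cmod (fourier f q - fourier g q)"
    by (metis norm_mult norm_triangle_ineq)
  also have "\<dots> \<le> cmod (fourier f p - fourier g p) * 1 + 1 * cmod (fourier f q - fourier g q)"
    by (intro add_mono mult_left_mono mult_right_mono norm_fourier_le_1 f g) auto
  finally have "ennreal (cmod (fourier f p * fourier f q - fourier g p * fourier g q))
      \<le> ennreal (cmod (fourier f p - fourier g p)) + ennreal (cmod (fourier f q - fourier g q))"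
    by (simp add: ennreal_plus[symmetric] ennreal_leI del: ennreal_plus)
  also have "\<dots> \<le> fourier_dist s f g * ennreal (norm p powr s) + fourier_dist s f g * ennreal (norm q powr s)"
    by (intro add_mono fourier_diff_le_fourier_dist) (simp_all add: fourier_0[OF f] fourier_0[OF g])
  finally show ?thesis by (simp add: distrib_left)
qed

lemma fourier_gain_diff_le:
  assumes mu: "real_distribution \<mu>"
    and f: "prob_space f" "sets f = sets borel" and g: "prob_space g" "sets g = sets borel"
  shows "ennreal (cmod (fourier (gain e \<mu> f) k - fourier (gain e \<mu> g) k))
    \<le> ennreal (1 / (4 * pi)) * (\<integral>\<^sup>+\<eta>. \<integral>\<^sup>+\<sigma>. fourier_dist s f g *
        (ennreal (norm (k_plus (e + \<eta>) k \<sigma>) powr s) + ennreal (norm (k_minus (e + \<eta>) k \<sigma>) powr s))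
        \<partial>sphere_measure \<partial>\<mu>)"
proof -
  let ?F = "\<lambda>\<eta> \<sigma>. fourier f (k_plus (e + \<eta>) k \<sigma>) * fourier f (k_minus (e + \<eta>) k \<sigma>)"
  let ?G = "\<lambda>\<eta> \<sigma>. fourier g (k_plus (e + \<eta>) k \<sigma>) * fourier g (k_minus (e + \<eta>) k \<sigma>)"
  note If = integrable_angular_fourier_product[OF mu f]
  note Ig = integrable_angular_fourier_product[OF mu g]
  have "fourier (gain e \<mu> f) k - fourier (gain e \<mu> g) k = complex_of_real (1 / (4 * pi)) *
      ((\<integral>\<eta>. \<integral>\<sigma>. ?F \<eta> \<sigma> \<partial>sphere_measure \<partial>\<mu>) - (\<integral>\<eta>. \<integral>\<sigma>. ?G \<eta> \<sigma> \<partial>sphere_measure \<partial>\<mu>))"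
    by (simp only: fourier_gain[OF mu f] fourier_gain[OF mu g] right_diff_distrib)
  also have "(\<integral>\<eta>. \<integral>\<sigma>. ?F \<eta> \<sigma> \<partial>sphere_measure \<partial>\<mu>) - (\<integral>\<eta>. \<integral>\<sigma>. ?G \<eta> \<sigma> \<partial>sphere_measure \<partial>\<mu>)
      = (\<integral>\<eta>. \<integral>\<sigma>. ?F \<eta> \<sigma> - ?G \<eta> \<sigma> \<partial>sphere_measure \<partial>\<mu>)"
    by (simp only: Bochner_Integration.integral_diff[OF If(1) Ig(1)] Bochner_Integration.integral_diff[OF If(2) Ig(2)])
  finally have "cmod (fourier (gain e \<mu> f) k - fourier (gain e \<mu> g) k)
      = 1 / (4 * pi) * cmod (\<integral>\<eta>. \<integral>\<sigma>. ?F \<eta> \<sigma> - ?G \<eta> \<sigma> \<partial>sphere_measure \<partial>\<mu>)"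
    by (simp only: norm_mult norm_of_real) simp
  then have "ennreal (cmod (fourier (gain e \<mu> f) k - fourier (gain e \<mu> g) k))
      = ennreal (1 / (4 * pi)) * ennreal (cmod (\<integral>\<eta>. \<integral>\<sigma>. ?F \<eta> \<sigma> - ?G \<eta> \<sigma> \<partial>sphere_measure \<partial>\<mu>))"
    by (simp only: ennreal_mult'' norm_ge_zero)
  also have "\<dots> \<le> ennreal (1 / (4 * pi)) * (\<integral>\<^sup>+\<eta>. ennreal (cmod (\<integral>\<sigma>. ?F \<eta> \<sigma> - ?G \<eta> \<sigma> \<partial>sphere_measure)) \<partial>\<mu>)"
  proof (intro mult_left_mono integral_norm_bound_ennreal)
    show "integrable \<mu> (\<lambda>\<eta>. \<integral>\<sigma>. ?F \<eta> \<sigma> - ?G \<eta> \<sigma> \<partial>sphere_measure)"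
      unfolding Bochner_Integration.integral_diff[OF If(1) Ig(1)]
      by (rule Bochner_Integration.integrable_diff[OF If(2) Ig(2)])
  qed simp
  also have "\<dots> \<le> ennreal (1 / (4 * pi)) * (\<integral>\<^sup>+\<eta>. \<integral>\<^sup>+\<sigma>. ennreal (cmod (?F \<eta> \<sigma> - ?G \<eta> \<sigma>)) \<partial>sphere_measure \<partial>\<mu>)"
    by (intro mult_left_mono nn_integral_mono integral_norm_bound_ennreal Bochner_Integration.integrable_diff If(1) Ig(1)) simp
  also have "\<dots> \<le> ennreal (1 / (4 * pi)) * (\<integral>\<^sup>+\<eta>. \<integral>\<^sup>+\<sigma>. fourier_dist s f g *
        (ennreal (norm (k_plus (e + \<eta>) k \<sigma>) powr s) + ennreal (norm (k_minus (e + \<eta>) k \<sigma>) powr s))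
        \<partial>sphere_measure \<partial>\<mu>)"
    by (intro mult_left_mono nn_integral_mono fourier_product_diff_le f g) simp
  finally show ?thesis .
qed

lemma measurable_const_add_real_distribution:
  "real_distribution \<mu> \<Longrightarrow> h \<in> borel_measurable borel \<Longrightarrow> (\<lambda>\<eta>. h (e + \<eta>)) \<in> borel_measurable \<mu>"
  by (simp add: real_distribution_def real_distribution_axioms_def cong: measurable_cong_sets)

text \<open>Divide the estimate for the frequency \<open>k\<close> by \<open>|k|\<close> to the power \<open>2 + \<alpha>\<close>. The averages of
  \<open>|k_plus|\<close> and \<open>|k_minus|\<close> to this power add up to a multiple of the same power of \<open>|k|\<close>, so what remains is the expectation of the
  contraction rate. All integrals are taken in \<open>[0,\<infinity>]\<close>, so an infinite constant or an infinite
  distance is covered by the same computation.\<close>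

lemma fourier_dist_gain_le:
  assumes mu: "real_distribution \<mu>" and et: "AE \<eta> in \<mu>. 0 \<le> e + \<eta>" and \<alpha>: "0 \<le> \<alpha>"
    and f: "prob_space f" "sets f = sets borel" and g: "prob_space g" "sets g = sets borel"
  shows "fourier_dist (2 + \<alpha>) (gain e \<mu> f) (gain e \<mu> g)
    \<le> contraction_const \<alpha> e \<mu> * fourier_dist (2 + \<alpha>) f g"
  unfolding fourier_dist_def[of _ "gain e \<mu> f"]
proof (rule SUP_least)
  fix k :: "real^3" assume "k \<in> UNIV - {0}"
  then have k: "norm k powr (2 + \<alpha>) > 0" by simp
  let ?s = "2 + \<alpha>"
  let ?d = "fourier_dist ?s f g" and ?D = "cmod (fourier (gain e \<mu> f) k - fourier (gain e \<mu> g) k)"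
  have mr: "(\<lambda>\<eta>. ennreal (contraction_rate \<alpha> (e + \<eta>))) \<in> borel_measurable \<mu>"
    by (rule measurable_const_add_real_distribution[OF mu]) measurable
  have ms: "(\<lambda>\<sigma>. ennreal (norm (k_plus et k \<sigma>) powr ?s) + ennreal (norm (k_minus et k \<sigma>) powr ?s))
      \<in> borel_measurable sphere_measure" for et
    by (rule measurable_compose[OF measurable_sphere_measure_ident]) measurable
  have c: "norm k powr ?s * (4 * pi * (2 / (4 + \<alpha>))) \<ge> 0" using \<alpha> by auto
  have "(\<integral>\<^sup>+\<eta>. \<integral>\<^sup>+\<sigma>. ?d *
        (ennreal (norm (k_plus (e + \<eta>) k \<sigma>) powr ?s) + ennreal (norm (k_minus (e + \<eta>) k \<sigma>) powr ?s))
        \<partial>sphere_measure \<partial>\<mu>)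
      = (\<integral>\<^sup>+\<eta>. ?d * ennreal (norm k powr ?s * (4 * pi * (2 / (4 + \<alpha>)))) * ennreal (contraction_rate \<alpha> (e + \<eta>)) \<partial>\<mu>)"
  proof (rule nn_integral_cong_AE, use et in eventually_elim)
    fix \<eta> assume "0 \<le> e + \<eta>"
    from nn_integral_sphere_contraction_rate[OF this \<alpha>, of k]
    show "(\<integral>\<^sup>+\<sigma>. ?d *
        (ennreal (norm (k_plus (e + \<eta>) k \<sigma>) powr ?s) + ennreal (norm (k_minus (e + \<eta>) k \<sigma>) powr ?s))
        \<partial>sphere_measure)
      = ?d * ennreal (norm k powr ?s * (4 * pi * (2 / (4 + \<alpha>)))) * ennreal (contraction_rate \<alpha> (e + \<eta>))"
      using c by (simp only: nn_integral_cmult[OF ms] mult.assoc[symmetric] ennreal_mult')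
  qed
  also have "\<dots> = ?d * ennreal (norm k powr ?s * (4 * pi * (2 / (4 + \<alpha>)))) * (\<integral>\<^sup>+\<eta>. ennreal (contraction_rate \<alpha> (e + \<eta>)) \<partial>\<mu>)"
    by (rule nn_integral_cmult[OF mr])
  finally have "ennreal ?D \<le> ennreal (1 / (4 * pi)) * (?d * ennreal (norm k powr ?s * (4 * pi * (2 / (4 + \<alpha>))))
      * (\<integral>\<^sup>+\<eta>. ennreal (contraction_rate \<alpha> (e + \<eta>)) \<partial>\<mu>))"
    using fourier_gain_diff_le[OF mu f g, of e k ?s] by simp
  also have "\<dots> = ?d * (ennreal (1 / (4 * pi)) * ennreal (norm k powr ?s * (4 * pi * (2 / (4 + \<alpha>)))))
      * (\<integral>\<^sup>+\<eta>. ennreal (contraction_rate \<alpha> (e + \<eta>)) \<partial>\<mu>)"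
    by (simp only: mult_ac)
  also have "ennreal (1 / (4 * pi)) * ennreal (norm k powr ?s * (4 * pi * (2 / (4 + \<alpha>))))
      = ennreal (norm k powr ?s) * ennreal (2 / (4 + \<alpha>))"
    using \<alpha> by (simp add: ennreal_mult[symmetric])
  also have "?d * (ennreal (norm k powr ?s) * ennreal (2 / (4 + \<alpha>))) * (\<integral>\<^sup>+\<eta>. ennreal (contraction_rate \<alpha> (e + \<eta>)) \<partial>\<mu>)
      = contraction_const \<alpha> e \<mu> * ?d * ennreal (norm k powr ?s)"
    by (simp only: contraction_const_eq mult_ac)
  finally have *: "ennreal ?D \<le> contraction_const \<alpha> e \<mu> * ?d * ennreal (norm k powr ?s)" .
  have "ennreal (?D / norm k powr ?s) = ennreal ?D * ennreal (1 / norm k powr ?s)"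
    by (simp add: ennreal_mult[symmetric])
  also have "\<dots> \<le> contraction_const \<alpha> e \<mu> * ?d * ennreal (norm k powr ?s) * ennreal (1 / norm k powr ?s)"
    by (intro mult_right_mono *) simp
  also have "\<dots> = contraction_const \<alpha> e \<mu> * ?d * (ennreal (norm k powr ?s) * ennreal (1 / norm k powr ?s))"
    by (simp only: mult.assoc)
  also have "ennreal (norm k powr ?s) * ennreal (1 / norm k powr ?s) = 1"
    using k by (simp add: ennreal_mult[symmetric])
  finally show "ennreal (?D / norm k powr ?s) \<le> contraction_const \<alpha> e \<mu> * ?d" by simp
qed

lemma contraction_const_pos:
  assumes mu: "real_distribution \<mu>" and et: "AE \<eta> in \<mu>. 0 \<le> e + \<eta>" and \<alpha>: "0 \<le> \<alpha>"
  shows "0 < contraction_const \<alpha> e \<mu>"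
proof -
  interpret mu: real_distribution \<mu> by fact
  have mr: "(\<lambda>\<eta>. ennreal (contraction_rate \<alpha> (e + \<eta>))) \<in> borel_measurable \<mu>"
    by (rule measurable_const_add_real_distribution[OF mu]) measurable
  have "(\<integral>\<^sup>+\<eta>. ennreal (contraction_rate \<alpha> (e + \<eta>)) \<partial>\<mu>) \<noteq> 0"
  proof
    assume "(\<integral>\<^sup>+\<eta>. ennreal (contraction_rate \<alpha> (e + \<eta>)) \<partial>\<mu>) = 0"
    then have "AE \<eta> in \<mu>. ennreal (contraction_rate \<alpha> (e + \<eta>)) = 0"
      using nn_integral_0_iff_AE[OF mr] by simp
    with et have "AE \<eta> in \<mu>. False"
    proof eventually_elim
      case (elim \<eta>)
      then show ?case using contraction_rate_pos[OF elim(1) \<alpha>] by (simp add: ennreal_eq_0_iff)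
    qed
    then show False by simp
  qed
  then show ?thesis using \<alpha> by (simp add: contraction_const_eq ennreal_zero_less_mult_iff zero_less_iff_neq_zero)
qed

lemma contraction_const_finite:
  assumes mu: "real_distribution \<mu>" and e: "0 \<le> e" "e \<le> 1"
    and et: "AE \<eta> in \<mu>. 0 \<le> e + \<eta>" and \<alpha>: "0 \<le> \<alpha>"
    and int: "integrable \<mu> (\<lambda>\<eta>. \<bar>\<eta>\<bar> powr (2 + \<alpha>))"
  shows "contraction_const \<alpha> e \<mu> < \<infinity>"
proof -
  interpret mu: real_distribution \<mu> by fact
  let ?s = "2 + \<alpha>"
  let ?B = "\<lambda>\<eta>. (4 + \<alpha>) * (4 powr ?s + 2 powr ?s * \<bar>\<eta>\<bar> powr ?s)"
  have "(\<integral>\<^sup>+\<eta>. ennreal (contraction_rate \<alpha> (e + \<eta>)) \<partial>\<mu>) \<le> (\<integral>\<^sup>+\<eta>. ennreal (?B \<eta>) \<partial>\<mu>)"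
  proof (rule nn_integral_mono_AE, use et in eventually_elim)
    case (elim \<eta>)
    \<comment> \<open>\<open>1 + e + \<eta> \<le> 2 + |\<eta>|\<close>, and a sum is at most twice the larger term\<close>
    have "(1 + (e + \<eta>)) powr ?s \<le> (max 4 (2 * \<bar>\<eta>\<bar>)) powr ?s"
      using elim e \<alpha> by (intro powr_mono2) auto
    also have "\<dots> \<le> 4 powr ?s + (2 * \<bar>\<eta>\<bar>) powr ?s" by (auto simp: max_def)
    also have "(2 * \<bar>\<eta>\<bar>) powr ?s = 2 powr ?s * \<bar>\<eta>\<bar> powr ?s" by (simp add: powr_mult)
    finally have "(4 + \<alpha>) * (1 + (e + \<eta>)) powr ?s \<le> ?B \<eta>" using \<alpha> by (intro mult_left_mono) auto
    with contraction_rate_le[OF elim \<alpha>] show ?case by (intro ennreal_leI) linarith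
  qed
  also have "\<dots> < \<infinity>"
  proof -
    have "integrable \<mu> ?B" using int by simp
    then show ?thesis using \<alpha> by (simp add: nn_integral_eq_integral)
  qed
  finally show ?thesis by (simp add: contraction_const_eq ennreal_mult_less_top)
qed

theorem theorem5p4:
  fixes e \<beta> \<alpha> :: real and \<mu> :: "real measure" and f g :: "(real^3) measure"
  assumes "0 \<le> e" "e \<le> 1"
    and "real_distribution \<mu>"
    and "AE \<eta> in \<mu>. - e \<le> \<eta>"
    and "has_bochner_integral \<mu> (\<lambda>\<eta>. \<eta>) 0"
    and "has_bochner_integral \<mu> (\<lambda>\<eta>. \<eta>\<^sup>2) (\<beta>\<^sup>2)"
    and "0 \<le> \<alpha>"
    and "f \<in> prob_moment (2 + \<alpha>)" "g \<in> prob_moment (2 + \<alpha>)"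
    and "equal_moments (2 + nat \<lfloor>\<alpha>\<rfloor>) f g"
  shows "0 < contraction_const \<alpha> e \<mu>
    \<and> (integrable \<mu> (\<lambda>\<eta>. \<bar>\<eta>\<bar> powr (2 + \<alpha>)) \<longrightarrow> contraction_const \<alpha> e \<mu> < \<infinity>)
    \<and> fourier_dist (2 + \<alpha>) (gain e \<mu> f) (gain e \<mu> g)
        \<le> contraction_const \<alpha> e \<mu> * fourier_dist (2 + \<alpha>) f g"
proof -
  have et: "AE \<eta> in \<mu>. 0 \<le> e + \<eta>"
    using assms(4) by eventually_elim simp
  have f: "prob_space f" "sets f = sets borel" and g: "prob_space g" "sets g = sets borel"
    using assms(8,9) by (auto simp: prob_moment_def)
  show ?thesis
    using contraction_const_pos[OF assms(3) et assms(7)]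
      contraction_const_finite[OF assms(3,1,2) et assms(7)]
      fourier_dist_gain_le[OF assms(3) et assms(7) f g] by blast
qed

end
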